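(* Let $G$ be a planar graph. (i) If $g(G)\ge 7$, then $\chi_{so}(G)\le \Delta(G)+4$. (ii) If $g(G)\ge 8$, then $\chi_{so}(G)\le \Delta(G)+3$.
   Context: All graphs are finite and simple. $\Delta(G)$ is the maximum degree of $G$, and $N_G(v)$ is the set of neighbors of $v$ in $G$. The girth $g(G)$ is the length of a shortest cycle in $G$ (with the usual convention $g(G)=\infty$ if $G$ has no cycle). For a positive integer $k$, a strong odd $k$-coloring of $G$ is a proper coloring of $G$ with colors in $\{1,\ldots,k\}$ (adjacent vertices receive different colors) such that for every non-isolated vertex $v$, if a color appears in $N_G(v)$, then it appears on an odd number of vertices of $N_G(v)$. The strong odd chromatic number $\chi_{so}(G)$ is the minimum $k$ such that $G$ has a strong odd $k$-coloring. *)

theory Defs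
  imports
    "HOL-Analysis.Analysis"
    "HOL-Library.Extended_Nat"
    "Graph_Theory.Pair_Digraph"
begin

text \<open>
  Finite simple graphs are represented by the locale predicate \<open>pair_graph\<close>: a finite
  vertex set \<open>pverts G\<close> together with a symmetric, irreflexive relation
  \<open>parcs G\<close> on it. An undirected edge \<open>{u, v}\<close> corresponds to the two arcs
  \<open>(u, v)\<close> and \<open>(v, u)\<close>; consequently the degree of a vertex is its
  \<open>out_degree\<close>.
\<close>

definition nbrs :: "'a pair_pre_digraph \<Rightarrow> 'a \<Rightarrow> 'a set" where
  "nbrs G v = {u. (v, u) \<in> parcs G}"

text \<open>The inserted 0 only matters for the graph without vertices.\<close>

definition max_degree :: "'a pair_pre_digraph \<Rightarrow> nat" where
  "max_degree G = Max (insert 0 (out_degree (with_proj G) ` pverts G))"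

text \<open>
  The notion \<open>pre_digraph.cycle\<close> also admits the closed walk \<open>(u, v), (v, u)\<close> along a single
  undirected edge, hence the bound on the length. The infimum of the empty set is \<open>\<infinity>\<close>.
\<close>

definition girth :: "'a pair_pre_digraph \<Rightarrow> enat" where
  "girth G = Inf {enat (length p) | p. pre_digraph.cycle (with_proj G) p \<and> 3 \<le> length p}"

text \<open>
  A drawing in the plane without crossings: \<open>\<phi>\<close> places the vertices, and
  \<open>L {u, v}\<close> is the point set of the (arbitrary continuous) simple arc that represents the
  edge \<open>{u, v}\<close>, endpoints included.
\<close>

definition plane_drawing ::
    "'a pair_pre_digraph \<Rightarrow> ('a \<Rightarrow> complex) \<Rightarrow> ('a set \<Rightarrow> complex set) \<Rightarrow> bool" where
  "plane_drawing G \<phi> L \<longleftrightarrow>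
     inj_on \<phi> (pverts G) \<and>
     (\<forall>(u, v) \<in> parcs G. \<exists>g. arc g \<and> pathstart g = \<phi> u \<and> pathfinish g = \<phi> v \<and>
        path_image g = L {u, v}) \<and>
     (\<forall>(u, v) \<in> parcs G. \<forall>w \<in> pverts G. \<phi> w \<in> L {u, v} \<longrightarrow> w \<in> {u, v}) \<and>
     (\<forall>(u, v) \<in> parcs G. \<forall>(x, y) \<in> parcs G. {u, v} \<noteq> {x, y} \<longrightarrow>
        L {u, v} \<inter> L {x, y} \<subseteq> \<phi> ` ({u, v} \<inter> {x, y}))"

definition planar :: "'a pair_pre_digraph \<Rightarrow> bool" where
  "planar G \<longleftrightarrow> (\<exists>\<phi> L. plane_drawing G \<phi> L)"

definition strong_odd_coloring :: "'a pair_pre_digraph \<Rightarrow> nat \<Rightarrow> ('a \<Rightarrow> nat) \<Rightarrow> bool" where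
  "strong_odd_coloring G k c \<longleftrightarrow>
     (\<forall>v \<in> pverts G. c v \<in> {1..k}) \<and>
     (\<forall>(u, v) \<in> parcs G. c u \<noteq> c v) \<and>
     (\<forall>v \<in> pverts G. nbrs G v \<noteq> {} \<longrightarrow>
        (\<forall>i \<in> c ` nbrs G v. odd (card {u \<in> nbrs G v. c u = i})))"

definition strong_odd_chromatic_number :: "'a pair_pre_digraph \<Rightarrow> nat" where
  "strong_odd_chromatic_number G = (LEAST k. 0 < k \<and> (\<exists>c. strong_odd_coloring G k c))"

text \<open>The minimum is attained: colouring all vertices differently is always possible.\<close>

lemma strong_odd_coloring_exists:
  assumes "pair_graph G"
  shows "\<exists>k>0. \<exists>c. strong_odd_coloring G k c"
proof -
  interpret pair_graph G by fact
  obtain f :: "'a \<Rightarrow> nat" where f: "inj_on f (pverts G)" "f ` pverts G = {0..<card (pverts G)}"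
    using ex_bij_betw_finite_nat[OF pair_finite_verts] by (auto simp: bij_betw_def)
  have "strong_odd_coloring G (Suc (card (pverts G))) (Suc \<circ> f)"
    unfolding strong_odd_coloring_def
  proof (intro conjI ballI impI, goal_cases)
    case (1 v)
    then have "f v \<in> {0..<card (pverts G)}" using f(2) by blast
    then show ?case by auto
  next
    case (2 e)
    then show ?case
      using f(1) wellformed' pair_no_loops by (fastforce dest: inj_onD)
  next
    case (3 v i)
    then obtain u where u: "u \<in> nbrs G v" "i = Suc (f u)" by auto
    have "{w \<in> nbrs G v. (Suc \<circ> f) w = i} = {u}"
      using u f(1) wellformed' by (auto simp: nbrs_def dest: inj_onD)
    then show ?case by simp
  qed
  then show ?thesis by blast
qed

end

theory Submission
  imports Defs
begin

text \<open>The argument has two independent halves. A plane graph of girth at least \<open>g\<close> is sparse: all its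
  nonempty induced subgraphs have average degree less than \<open>2g / (g - 2)\<close>, which is \<open>14/5\<close> for
  \<open>g = 7\<close> and \<open>8/3\<close> for \<open>g = 8\<close>. And a graph that is sparse in this sense and has girth at least
  7 can be coloured with \<open>\<Delta> + 4\<close>, respectively \<open>\<Delta> + 3\<close>, colours.

  Sparsity follows from Euler's formula. A graph on at least three vertices
  without a separation of order at most one grows from a cycle by adding ears, that is, paths that meet the part built so far in their two ends only. An
  ear lies in one face. By the Jordan curve theorem and its refinement for three arcs
  with common ends, \<open>arc_splits_component\<close>, it cuts the face into two, each again bounded by a
  cycle. So the number of faces and the sum of the lengths of their boundary cycles can be tracked
  (\<open>faces_ear\<close>): the former is the number of edges minus the number of vertices plus two, the latter
  is twice the number of edges, and it is at least \<open>g\<close> times the former. Graphs with a separation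
  of order at most one are handled by adding the bounds of the two sides (\<open>plane_graph_sparse\<close>).

  For the colouring, an induced subgraph \<open>X\<close> is called reducible if a colouring of \<open>X\<close> exists as
  soon as every proper induced subgraph has one. Deleting some vertices, colouring the rest
  and extending the colouring shows that three configurations make \<open>X\<close> reducible. The decisive one is
  \<open>star_reducible\<close>: a vertex of small degree all of whose neighbours, except possibly one, have
  degree two. Here strong odd colourings are easier to extend than colourings of the square: a colour
  that the exceptional neighbour already has may be given to two of the other neighbours, since three
  is odd. An \<open>X\<close> without these configurations has average degree at least \<open>8/3\<close>,
  respectively \<open>14/5\<close>, because vertices of degree two can be supported by their neighbours
  (\<open>dense_if_many_heavy_nbrs_8_3\<close>, \<open>dense_if_unavoidable_14_5\<close>). Hence every induced subgraph
  of a sparse graph is reducible, and induction on the vertex set gives the colouring.\<close>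

section \<open>Theta graphs in the plane\<close>

lemma Jordan_curve_two_arcs:
  fixes g h :: "real \<Rightarrow> complex"
  assumes g: "arc g" "pathstart g = a" "pathfinish g = b"
    and h: "arc h" "pathstart h = a" "pathfinish h = b"
    and gh: "path_image g \<inter> path_image h = {a,b}"
  defines "J \<equiv> path_image g \<union> path_image h"
  shows "components (- J) = {inside J, outside J}"
    and "frontier (inside J) = J"
    and "inside J \<noteq> {}"
    and "connected (inside J)" "connected (outside J)"
    and "compact J"
proof -
  let ?c = "g +++ reversepath h"
  have sp: "simple_path ?c"
    using assms by (auto simp: simple_path_join_loop_eq arc_reversepath)
  have im: "path_image ?c = J"
    using g h by (simp add: path_image_join J_def)
  have loop: "pathfinish ?c = pathstart ?c" using g h by simp
  note J = Jordan_inside_outside[OF sp loop, unfolded im]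
  show "frontier (inside J) = J" "inside J \<noteq> {}"
    "connected (inside J)" "connected (outside J)"
    using J by auto
  show "compact J" using g h by (auto simp: J_def arc_imp_path compact_path_image)
  have in1: "inside J \<in> components (- J)" "outside J \<in> components (- J)"
    using J by (auto simp: inside_in_components outside_in_components)
  show "components (- J) = {inside J, outside J}"
  proof (intro equalityI subsetI)
    fix R assume R: "R \<in> components (- J)"
    then obtain x where x: "x \<in> R" "x \<notin> J"
      by (metis ComplD all_not_in_conv in_components_nonempty in_components_subset subsetD)
    then have "x \<in> inside J \<union> outside J" by (simp add: inside_Un_outside)
    then show "R \<in> {inside J, outside J}"
      using x R in1 components_eq by (metis IntI Un_iff empty_iff insertI1 insertI2)
  qed (use in1 in auto)
qed

text \<open>Otherwise the inside of each of the three closed curves avoids the third arc. Two of these insides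
  cannot be nested, since their frontiers differ, so a point \<open>x\<close> inside the curve of the arcs 2 and 3
  is outside the other two curves. These two curves share exactly the arc 1, which is connected, and
  neither separates \<open>x\<close> from a far point \<open>y\<close>. By Janiszewski's theorem their union does not
  separate \<open>x\<close> from \<open>y\<close> either, although it contains the curve of the arcs 2 and 3.\<close>

lemma theta_some_arc_inside:
  fixes g1 g2 g3 :: "real \<Rightarrow> complex"
  assumes g1: "arc g1" "pathstart g1 = a" "pathfinish g1 = b"
    and g2: "arc g2" "pathstart g2 = a" "pathfinish g2 = b"
    and g3: "arc g3" "pathstart g3 = a" "pathfinish g3 = b"
    and i12: "path_image g1 \<inter> path_image g2 = {a,b}"
    and i13: "path_image g1 \<inter> path_image g3 = {a,b}"
    and i23: "path_image g2 \<inter> path_image g3 = {a,b}"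
  shows "path_image g1 \<inter> inside (path_image g2 \<union> path_image g3) \<noteq> {} \<or>
         path_image g2 \<inter> inside (path_image g1 \<union> path_image g3) \<noteq> {} \<or>
         path_image g3 \<inter> inside (path_image g1 \<union> path_image g2) \<noteq> {}"
proof (rule ccontr)
  let ?I1 = "path_image g1" and ?I2 = "path_image g2" and ?I3 = "path_image g3"
  assume "\<not> ?thesis"
  then have d: "?I1 \<inter> inside (?I2 \<union> ?I3) = {}" "?I2 \<inter> inside (?I1 \<union> ?I3) = {}"
    "?I3 \<inter> inside (?I1 \<union> ?I2) = {}" by auto
  note J12 = Jordan_curve_two_arcs[OF g1 g2 i12]
  note J13 = Jordan_curve_two_arcs[OF g1 g3 i13]
  note J23 = Jordan_curve_two_arcs[OF g2 g3 i23]
  have proper: "\<exists>x\<in>?I1. x \<notin> {a,b}" "\<exists>x\<in>?I2. x \<notin> {a,b}" "\<exists>x\<in>?I3. x \<notin> {a,b}"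
    using nonempty_simple_path_endless[OF arc_imp_simple_path[OF g1(1)]]
      nonempty_simple_path_endless[OF arc_imp_simple_path[OF g2(1)]]
      nonempty_simple_path_endless[OF arc_imp_simple_path[OF g3(1)]] g1 g2 g3 by auto
  have incl: "inside S \<subseteq> inside T \<or> inside S \<subseteq> outside T"
    if S: "connected (inside S)" "inside S \<inter> T = {}" "components (- T) = {inside T, outside T}"
       "inside S \<noteq> {}"
    for S T :: "complex set"
  proof -
    have "inside S \<subseteq> - T" using S(2) by auto
    then obtain C where "C \<in> components (- T)" "inside S \<subseteq> C"
      using exists_component_superset[of "inside S" "- T"] S by auto
    then show ?thesis using S(3) by auto
  qed
  \<comment> \<open>the Jordan domains of two of the curves cannot be nested, as their frontiers differ\<close>
  have out: "inside (?I2 \<union> ?I3) \<subseteq> outside (?I1 \<union> ?I3)" "inside (?I2 \<union> ?I3) \<subseteq> outside (?I1 \<union> ?I2)"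
  proof -
    have d': "inside (?I2 \<union> ?I3) \<inter> (?I1 \<union> ?I3) = {}" "inside (?I1 \<union> ?I3) \<inter> (?I2 \<union> ?I3) = {}"
      "inside (?I2 \<union> ?I3) \<inter> (?I1 \<union> ?I2) = {}" "inside (?I1 \<union> ?I2) \<inter> (?I2 \<union> ?I3) = {}"
      using d inside_no_overlap[of "?I2 \<union> ?I3"] inside_no_overlap[of "?I1 \<union> ?I3"]
        inside_no_overlap[of "?I1 \<union> ?I2"] by (simp_all add: Int_Un_distrib Int_Un_distrib2 Int_commute)
    have ne: "inside (?I2 \<union> ?I3) \<noteq> inside (?I1 \<union> ?I3)" "inside (?I2 \<union> ?I3) \<noteq> inside (?I1 \<union> ?I2)"
    proof -
      have "?I2 \<union> ?I3 \<noteq> ?I1 \<union> ?I3" "?I2 \<union> ?I3 \<noteq> ?I1 \<union> ?I2" using proper i12 i13 i23 by blast+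
      then show "inside (?I2 \<union> ?I3) \<noteq> inside (?I1 \<union> ?I3)" "inside (?I2 \<union> ?I3) \<noteq> inside (?I1 \<union> ?I2)"
        using J23(2) J13(2) J12(2) by metis+
    qed
    have "inside (?I2 \<union> ?I3) \<subseteq> inside (?I1 \<union> ?I3) \<Longrightarrow> inside (?I1 \<union> ?I3) \<subseteq> inside (?I2 \<union> ?I3)"
      using incl[OF J13(4) d'(2) J23(1) J13(3)] inside_Int_outside[of "?I2 \<union> ?I3", unfolded disjoint_iff] J23(3) by blast
    then show "inside (?I2 \<union> ?I3) \<subseteq> outside (?I1 \<union> ?I3)"
      using incl[OF J23(4) d'(1) J13(1) J23(3)] ne by auto
    have "inside (?I2 \<union> ?I3) \<subseteq> inside (?I1 \<union> ?I2) \<Longrightarrow> inside (?I1 \<union> ?I2) \<subseteq> inside (?I2 \<union> ?I3)"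
      using incl[OF J12(4) d'(4) J23(1) J12(3)] inside_Int_outside[of "?I2 \<union> ?I3", unfolded disjoint_iff] J23(3) by blast
    then show "inside (?I2 \<union> ?I3) \<subseteq> outside (?I1 \<union> ?I2)"
      using incl[OF J23(4) d'(3) J12(1) J23(3)] ne by auto
  qed
  obtain x where x: "x \<in> inside (?I2 \<union> ?I3)" using J23(3) by auto
  have bd: "bounded (?I1 \<union> ?I2 \<union> ?I3 \<union> inside (?I1 \<union> ?I3) \<union> inside (?I1 \<union> ?I2) \<union> inside (?I2 \<union> ?I3))"
    using J12(6) J13(6) J23(6)[THEN compact_imp_bounded] bounded_inside[OF compact_imp_bounded[OF J12(6)]]
      bounded_inside[OF compact_imp_bounded[OF J13(6)]] bounded_inside[OF compact_imp_bounded[OF J23(6)]]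
      compact_imp_bounded[OF J12(6)] by simp
  obtain y where y: "y \<notin> ?I1 \<union> ?I2 \<union> ?I3 \<union> inside (?I1 \<union> ?I3) \<union> inside (?I1 \<union> ?I2) \<union> inside (?I2 \<union> ?I3)"
    using bd not_bounded_UNIV by (metis UNIV_I bounded_subset subsetI)
  have yo: "y \<in> outside (?I1 \<union> ?I3)" "y \<in> outside (?I1 \<union> ?I2)" "y \<in> outside (?I2 \<union> ?I3)"
    using y inside_Un_outside[of "?I1 \<union> ?I3"] inside_Un_outside[of "?I1 \<union> ?I2"]
      inside_Un_outside[of "?I2 \<union> ?I3"] by (auto simp: outside_inside)
  have sub: "outside S \<subseteq> - S" for S :: "complex set" by (auto simp: outside_inside)
  have eq: "(?I1 \<union> ?I3) \<inter> (?I1 \<union> ?I2) = ?I1" using i12 i13 i23 by blast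
  have "connected_component (- ((?I1 \<union> ?I3) \<union> (?I1 \<union> ?I2))) x y"
  proof (rule Janiszewski)
    show "connected ((?I1 \<union> ?I3) \<inter> (?I1 \<union> ?I2))"
      using eq g1 by (simp add: arc_imp_path connected_path_image)
    show "connected_component (- (?I1 \<union> ?I3)) x y"
      by (rule connected_componentI[OF J13(5) sub]) (use yo x out in auto)
    show "connected_component (- (?I1 \<union> ?I2)) x y"
      by (rule connected_componentI[OF J12(5) sub]) (use yo x out in auto)
  qed (use J12(6) J13(6) compact_imp_closed in auto)
  then have "connected_component (- (?I2 \<union> ?I3)) x y"
    by (rule connected_component_of_subset) auto
  then show False
    using inside_same_component[OF _ x] yo(3) inside_Int_outside[of "?I2 \<union> ?I3", unfolded disjoint_iff] by blast
qed

text \<open>An arc across either side of a closed curve cuts that side into two pieces, each of which is a side of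
  one of the two new closed curves. For the bounded side this is
  \<open>split_inside_simple_closed_curve\<close>. If the new arc runs outside, then one of the two old arcs
  is inside the closed curve of the other two, and the same theorem, applied to that curve,
  describes the complement of all three arcs.\<close>

lemma arc_splits_component:
  fixes g1 g2 g :: "real \<Rightarrow> complex"
  assumes g1: "arc g1" "pathstart g1 = a" "pathfinish g1 = b"
    and g2: "arc g2" "pathstart g2 = a" "pathfinish g2 = b"
    and g: "arc g" "pathstart g = a" "pathfinish g = b"
    and i12: "path_image g1 \<inter> path_image g2 = {a,b}"
    and i1: "path_image g1 \<inter> path_image g = {a,b}"
    and i2: "path_image g2 \<inter> path_image g = {a,b}"
    and R: "R \<in> components (- (path_image g1 \<union> path_image g2))"
    and gR: "path_image g - {a,b} \<subseteq> R"
  shows "\<exists>R1 \<in> components (- (path_image g1 \<union> path_image g)).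
         \<exists>R2 \<in> components (- (path_image g2 \<union> path_image g)).
           R1 \<inter> R2 = {} \<and> R - path_image g = R1 \<union> R2"
proof -
  let ?I1 = "path_image g1" and ?I2 = "path_image g2" and ?I = "path_image g"
  have ab: "a \<noteq> b" using g by (metis arc_distinct_ends)
  have i1': "?I \<inter> ?I1 = {a,b}" and i2': "?I \<inter> ?I2 = {a,b}" and i21: "?I2 \<inter> ?I1 = {a,b}"
    using i1 i2 i12 by auto
  note J12 = Jordan_curve_two_arcs[OF g1 g2 i12]
  note J1 = Jordan_curve_two_arcs[OF g1 g i1]
  note J2 = Jordan_curve_two_arcs[OF g2 g i2]
  note sp = arc_imp_simple_path
  have endpts: "a \<in> ?I" "b \<in> ?I" "a \<in> ?I1" "b \<in> ?I1" "a \<in> ?I2" "b \<in> ?I2"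
    using i1 i2 by auto
  have gne: "?I - {a,b} \<noteq> {}" using nonempty_simple_path_endless[OF sp] g by auto
  have minus_arc: "(A \<union> B \<union> (?I - {a,b})) - ?I = A \<union> B" if "A \<inter> ?I = {}" "B \<inter> ?I = {}" for A B
    using that by auto
  \<comment> \<open>one old arc, \<open>I2\<close>, is inside the curve formed by \<open>I1\<close> and the new arc \<open>I\<close>\<close>
  have outside_minus_arc: "- (I1 \<union> I2) - inside (I1 \<union> I2) - I = (- (I1 \<union> I) - inside (I1 \<union> I)) \<union> inside (I2 \<union> I)"
    if h: "inside (I1 \<union> I2) \<inter> inside (I2 \<union> I) = {}"
      "inside (I1 \<union> I2) \<union> inside (I2 \<union> I) \<union> (I2 - {a,b}) = inside (I1 \<union> I)" "a \<in> I" "b \<in> I"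
    for I1 I2 I :: "complex set"
  proof (rule set_eqI)
    fix x
    have "x \<in> inside (I1 \<union> I2) \<Longrightarrow> x \<notin> I1 \<union> I2" "x \<in> inside (I2 \<union> I) \<Longrightarrow> x \<notin> I2 \<union> I"
      "x \<in> inside (I1 \<union> I) \<Longrightarrow> x \<notin> I1 \<union> I"
      by (meson disjoint_iff inside_no_overlap)+
    moreover have "x \<in> inside (I1 \<union> I) \<longleftrightarrow> x \<in> inside (I1 \<union> I2) \<or> x \<in> inside (I2 \<union> I) \<or> (x \<in> I2 \<and> x \<noteq> a \<and> x \<noteq> b)"
      unfolding h(2)[symmetric] by auto
    moreover have "\<not> (x \<in> inside (I1 \<union> I2) \<and> x \<in> inside (I2 \<union> I))" using h(1) by blast
    moreover have "x = a \<or> x = b \<Longrightarrow> x \<in> I" using h(3,4) by auto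
    ultimately show "x \<in> - (I1 \<union> I2) - inside (I1 \<union> I2) - I \<longleftrightarrow>
       x \<in> (- (I1 \<union> I) - inside (I1 \<union> I)) \<union> inside (I2 \<union> I)"
      unfolding Diff_iff Compl_iff Un_iff by argo
  qed
  consider "R = inside (?I1 \<union> ?I2)" | "R = outside (?I1 \<union> ?I2)" using R J12(1) by auto
  then show ?thesis
  proof cases
    case 1
    then have "?I \<inter> inside (?I1 \<union> ?I2) \<noteq> {}" using gR gne by auto
    from split_inside_simple_closed_curve[OF sp[OF g1(1)] g1(2,3) sp[OF g2(1)] g2(2,3)
        sp[OF g(1)] g(2,3) ab i12 i1 i2 this]
    have *: "inside (?I1 \<union> ?I) \<inter> inside (?I2 \<union> ?I) = {}"
      "inside (?I1 \<union> ?I) \<union> inside (?I2 \<union> ?I) \<union> (?I - {a,b}) = inside (?I1 \<union> ?I2)" by auto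
    from *(2) have "R - ?I = inside (?I1 \<union> ?I) \<union> inside (?I2 \<union> ?I)"
      using 1 inside_no_overlap[of "?I1 \<union> ?I"] inside_no_overlap[of "?I2 \<union> ?I"] endpts(1,2)
        minus_arc[of "inside (?I1 \<union> ?I)" "inside (?I2 \<union> ?I)"] by (simp add: Int_Un_distrib)
    then show ?thesis unfolding J1(1) J2(1) using *(1) by auto
  next
    case 2
    have out: "outside S = - S - inside S" for S :: "complex set"
      by (auto simp: outside_inside)
    have "?I \<subseteq> (?I1 \<union> ?I2) \<union> outside (?I1 \<union> ?I2)" using gR endpts unfolding 2 by auto
    then have "?I \<inter> inside (?I1 \<union> ?I2) = {}" unfolding out[of "?I1 \<union> ?I2"]
      using inside_no_overlap[of "?I1 \<union> ?I2"] by (auto simp: Int_commute)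
    then consider "?I2 \<inter> inside (?I1 \<union> ?I) \<noteq> {}" | "?I1 \<inter> inside (?I2 \<union> ?I) \<noteq> {}"
      using theta_some_arc_inside[OF g1 g2 g i12 i1 i2] by auto
    then show ?thesis
    proof cases
      case 1
      from split_inside_simple_closed_curve[OF sp[OF g1(1)] g1(2,3) sp[OF g(1)] g(2,3)
        sp[OF g2(1)] g2(2,3) ab i1 i12 i2' 1]
      have *: "inside (?I1 \<union> ?I2) \<inter> inside (?I2 \<union> ?I) = {}"
        "inside (?I1 \<union> ?I2) \<union> inside (?I2 \<union> ?I) \<union> (?I2 - {a,b}) = inside (?I1 \<union> ?I)"
        by (auto simp: Un_commute)
      have "R - ?I = outside (?I1 \<union> ?I) \<union> inside (?I2 \<union> ?I)"
        unfolding 2 out using * endpts by (intro outside_minus_arc) simp_all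
      moreover have "outside (?I1 \<union> ?I) \<inter> inside (?I2 \<union> ?I) = {}"
        unfolding out *(2)[symmetric] by auto
      ultimately show ?thesis unfolding J1(1) J2(1) by auto
    next
      case c2: 2
      from split_inside_simple_closed_curve[OF sp[OF g2(1)] g2(2,3) sp[OF g(1)] g(2,3)
        sp[OF g1(1)] g1(2,3) ab i2 i21 i1' c2]
      have *: "inside (?I1 \<union> ?I2) \<inter> inside (?I1 \<union> ?I) = {}"
        "inside (?I1 \<union> ?I2) \<union> inside (?I1 \<union> ?I) \<union> (?I1 - {a,b}) = inside (?I2 \<union> ?I)"
        by (auto simp: Un_commute)
      have "R - ?I = inside (?I1 \<union> ?I) \<union> outside (?I2 \<union> ?I)"
        unfolding 2 out
        using outside_minus_arc[of ?I2 ?I1 ?I] * endpts(1,2) by (simp add: Un_commute)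
      moreover have "inside (?I1 \<union> ?I) \<inter> outside (?I2 \<union> ?I) = {}"
        unfolding out *(2)[symmetric] by auto
      ultimately show ?thesis unfolding J1(1) J2(1) by auto
    qed
  qed
qed

section \<open>Paths and cycles as sets of arcs\<close>

text \<open>Both orientations of every edge of a path belong to its set of arcs, so that all sets of arcs below are
  symmetric and count each edge twice.\<close>

fun path_arcs :: "'a list \<Rightarrow> 'a rel" where
  "path_arcs (x # y # zs) = {(x, y), (y, x)} \<union> path_arcs (y # zs)"
| "path_arcs _ = {}"

lemma path_arcs_subset: "path_arcs p \<subseteq> set p \<times> set p"
  by (induction p rule: path_arcs.induct) auto

lemma sym_path_arcs: "sym (path_arcs p)"
  by (induction p rule: path_arcs.induct) (auto simp: sym_def)

lemma finite_path_arcs: "finite (path_arcs p)"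
  by (induction p rule: path_arcs.induct) auto

lemma path_arcs_append: "path_arcs (p @ x # q) = path_arcs (p @ [x]) \<union> path_arcs (x # q)"
proof (induction p)
  case Nil then show ?case by simp
next
  case (Cons y p)
  then show ?case by (cases p) auto
qed

lemma path_arcs_Cons: "p \<noteq> [] \<Longrightarrow> path_arcs (x # p) = {(x, hd p), (hd p, x)} \<union> path_arcs p"
  by (cases p) auto

lemma path_arcs_snoc: "p \<noteq> [] \<Longrightarrow> path_arcs (p @ [x]) = path_arcs p \<union> {(last p, x), (x, last p)}"
proof (induction p)
  case (Cons y p)
  then show ?case by (cases p) auto
qed simp

lemma path_arcs_rev: "path_arcs (rev p) = path_arcs p"
proof (induction p)
  case (Cons x p)
  show ?case
  proof (cases "p = []")
    case False
    then show ?thesis using Cons by (auto simp: path_arcs_snoc path_arcs_Cons last_rev)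
  qed simp
qed simp

lemma fst_path_arcs: "2 \<le> length p \<Longrightarrow> fst ` path_arcs p = set p"
proof (induction p rule: path_arcs.induct)
  case (1 x y zs)
  show ?case
  proof (cases zs)
    case (Cons z ws)
    then have "fst ` path_arcs (y # zs) = set (y # zs)" using 1 by simp
    then show ?thesis by auto
  qed simp
qed auto

lemma card_path_arcs: "distinct p \<Longrightarrow> card (path_arcs p) = 2 * (length p - 1)"
proof (induction p rule: path_arcs.induct)
  case (1 x y zs)
  have "(x, y) \<notin> path_arcs (y # zs)" "(y, x) \<notin> path_arcs (y # zs)" "(x, y) \<noteq> (y, x)"
    using path_arcs_subset[of "y # zs"] 1(2) by auto
  then show ?case using 1 finite_path_arcs[of "y # zs"] by (simp add: card_insert_if)
qed auto

lemma ends_in_path_arcs: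
  assumes "distinct (a # xs @ [b])" "(a, b) \<in> path_arcs (a # xs @ [b])"
  shows "xs = []"
proof (rule ccontr)
  assume "xs \<noteq> []"
  then have "path_arcs (a # xs @ [b]) = {(a, hd xs), (hd xs, a)} \<union> path_arcs (xs @ [b])"
    by (simp add: path_arcs_Cons)
  then show False using assms path_arcs_subset[of "xs @ [b]"] \<open>xs \<noteq> []\<close> by auto
qed

definition cycle_arcs :: "'a list \<Rightarrow> 'a rel" where
  "cycle_arcs C = path_arcs (C @ [hd C])"

definition cycle_in :: "'a rel \<Rightarrow> 'a list \<Rightarrow> bool" where
  "cycle_in B C \<longleftrightarrow> distinct C \<and> 3 \<le> length C \<and> cycle_arcs C \<subseteq> B"

lemma cycle_arcs_two_paths:
  "cycle_arcs (a # xs @ b # ys) = path_arcs (a # xs @ [b]) \<union> path_arcs (b # ys @ [a])"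
  using path_arcs_append[of "a # xs" b "ys @ [a]"] by (simp add: cycle_arcs_def)

text \<open>Rotating the list such that \<open>a\<close> comes first shows the two paths between \<open>a\<close> and \<open>b\<close> in a cycle.\<close>

lemma cycle_split:
  assumes "distinct C" "a \<in> set C" "b \<in> set C" "a \<noteq> b"
  obtains xs ys where "distinct (a # xs @ b # ys)" "length C = length xs + length ys + 2"
    "cycle_arcs C = path_arcs (a # xs @ [b]) \<union> path_arcs (b # ys @ [a])"
proof -
  obtain p q where C: "C = p @ a # q" using assms(2) by (auto simp: in_set_conv_decomp)
  have rot: "cycle_arcs C = path_arcs (a # (q @ p) @ [a])"
  proof (cases p)
    case Nil
    then show ?thesis using C by (simp add: cycle_arcs_def)
  next
    case (Cons h p')
    then show ?thesis
      using C path_arcs_append[of "h # p'" a "q @ [h]"] path_arcs_append[of "a # q" h "p' @ [a]"]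
      by (auto simp: cycle_arcs_def)
  qed
  have "b \<in> set (q @ p)" using C assms by auto
  then obtain xs ys where qp: "q @ p = xs @ b # ys" by (auto simp only: in_set_conv_decomp)
  have "distinct (a # q @ p)" using C assms by auto
  then have d: "distinct (a # xs @ b # ys)" using qp by auto
  have "length (q @ p) = length xs + length ys + 1" using qp by simp
  then have l: "length C = length xs + length ys + 2" using C by simp
  have "cycle_arcs C = path_arcs (a # xs @ [b]) \<union> path_arcs (b # ys @ [a])"
    using rot qp path_arcs_append[of "a # xs" b "ys @ [a]"] by simp
  then show thesis using that d l by blast
qed

text \<open>A common arc would join \<open>a\<close> and \<open>b\<close>, but a path of length at least two does not contain the
  edge between its ends.\<close>

lemma two_paths_disjoint:
  assumes "distinct (a # xs @ b # ys)" "xs \<noteq> [] \<or> ys \<noteq> []"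
  shows "path_arcs (a # xs @ [b]) \<inter> path_arcs (b # ys @ [a]) = {}"
proof (rule ccontr)
  assume "\<not> ?thesis"
  then obtain u v where uv: "(u, v) \<in> path_arcs (a # xs @ [b])" "(u, v) \<in> path_arcs (b # ys @ [a])" by auto
  then have "u \<in> {a,b}" "v \<in> {a,b}"
    using path_arcs_subset[of "a # xs @ [b]"] path_arcs_subset[of "b # ys @ [a]"] assms(1) by auto
  moreover have "u \<noteq> v" using uv(1) assms(1)
  proof -
    have "u \<noteq> v" if "(u, v) \<in> path_arcs p" "distinct p" for p :: "'a list"
      using that by (induction p rule: path_arcs.induct) auto
    from this[OF uv(1)] show ?thesis using assms(1) by auto
  qed
  ultimately have "(a, b) \<in> path_arcs (a # xs @ [b])" "(b, a) \<in> path_arcs (b # ys @ [a])"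
    using uv symD[OF sym_path_arcs uv(1)] symD[OF sym_path_arcs uv(2)] by auto
  then show False using ends_in_path_arcs[of a xs b] ends_in_path_arcs[of b ys a] assms by auto
qed

lemma two_paths_of_cycle:
  assumes "distinct C" "3 \<le> length C"
  obtains a b ys where "C = a # [] @ b # ys" "ys \<noteq> []"
  using assms by (cases C; cases "tl C"; cases "tl (tl C)") auto

lemma card_cycle_arcs:
  assumes "distinct C" "3 \<le> length C"
  shows "card (cycle_arcs C) = 2 * length C"
proof -
  obtain a b ys where C: "C = a # [] @ b # ys" "ys \<noteq> []" using two_paths_of_cycle[OF assms] .
  have "card (cycle_arcs C) = card (path_arcs (a # [] @ [b])) + card (path_arcs (b # ys @ [a]))"
    unfolding C(1) cycle_arcs_two_paths
    using two_paths_disjoint[of a "[]" b ys] C assms finite_path_arcs by (intro card_Un_disjoint) auto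
  then show ?thesis using card_path_arcs[of "[a,b]"] card_path_arcs[of "b # ys @ [a]"] C assms by auto
qed

lemma fst_cycle_arcs: "C \<noteq> [] \<Longrightarrow> fst ` cycle_arcs C = set C"
  unfolding cycle_arcs_def by (subst fst_path_arcs) (auto simp: Suc_le_eq)

lemma sym_cycle_arcs: "sym (cycle_arcs C)"
  unfolding cycle_arcs_def by (rule sym_path_arcs)

lemma finite_cycle_arcs: "finite (cycle_arcs C)"
  unfolding cycle_arcs_def by (rule finite_path_arcs)

section \<open>Faces of plane graphs\<close>

text \<open>What a plane drawing says about arcs and their ends. Taking the ends of arcs as the vertices makes
  the set \<open>A\<close> of arcs the only graph-theoretic parameter.\<close>

locale plane_graph =
  fixes A :: "'a rel" and \<phi> :: "'a \<Rightarrow> complex" and L :: "'a set \<Rightarrow> complex set"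
  assumes sym_A: "sym A"
    and edge_arc: "(u, v) \<in> A \<Longrightarrow> \<exists>g. arc g \<and> pathstart g = \<phi> u \<and> pathfinish g = \<phi> v \<and> path_image g = L {u, v}"
    and vertex_on_edge: "(u, v) \<in> A \<Longrightarrow> w \<in> fst ` A \<Longrightarrow> \<phi> w \<in> L {u, v} \<Longrightarrow> w \<in> {u, v}"
    and edges_Int: "(u, v) \<in> A \<Longrightarrow> (x, y) \<in> A \<Longrightarrow> {u, v} \<noteq> {x, y} \<Longrightarrow>
        L {u, v} \<inter> L {x, y} \<subseteq> \<phi> ` ({u, v} \<inter> {x, y})"
begin

definition drawn :: "'a rel \<Rightarrow> complex set" where
  "drawn B = (\<Union>(u, v) \<in> B. L {u, v})"

lemma drawn_Un: "drawn (B \<union> B') = drawn B \<union> drawn B'"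
  by (auto simp: drawn_def)

lemma drawn_mono: "B \<subseteq> B' \<Longrightarrow> drawn B \<subseteq> drawn B'"
  by (auto simp: drawn_def)

lemma closed_drawn:
  assumes "finite B" "B \<subseteq> A"
  shows "closed (drawn B)"
  unfolding drawn_def
proof (rule closed_UN[OF assms(1)], rule ballI)
  fix e assume "e \<in> B"
  then obtain u v where e: "e = (u, v)" "(u, v) \<in> A" using assms by (cases e) auto
  then obtain g where "arc g" "path_image g = L {u, v}" using edge_arc by blast
  then show "closed (case e of (u, v) \<Rightarrow> L {u, v})"
    using e closed_arc_image by force
qed

lemma drawn_Int:
  assumes "P \<subseteq> A" "Q \<subseteq> A" "sym P" "sym Q" "P \<inter> Q = {}"
  shows "drawn P \<inter> drawn Q \<subseteq> \<phi> ` (fst ` P \<inter> fst ` Q)"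
proof
  fix z assume "z \<in> drawn P \<inter> drawn Q"
  then obtain u v x y where uv: "(u, v) \<in> P" "z \<in> L {u, v}" and xy: "(x, y) \<in> Q" "z \<in> L {x, y}"
    by (auto simp: drawn_def)
  have "{u, v} \<noteq> {x, y}" using assms uv xy by (auto simp: doubleton_eq_iff dest: symD)
  then obtain w where w: "w \<in> {u, v}" "w \<in> {x, y}" "z = \<phi> w"
    using edges_Int[of u v x y] uv xy assms by blast
  have "w \<in> fst ` P" "w \<in> fst ` Q"
    using w uv xy symD[OF assms(3) uv(1)] symD[OF assms(4) xy(1)] by force+
  then show "z \<in> \<phi> ` (fst ` P \<inter> fst ` Q)" using w by auto
qed

lemma vertex_drawn:
  assumes "B \<subseteq> A" "u \<in> fst ` B"
  shows "\<phi> u \<in> drawn B"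
proof -
  obtain v where v: "(u, v) \<in> B" using assms by auto
  then obtain g where "pathstart g = \<phi> u" "path_image g = L {u, v}" using assms edge_arc by blast
  then show ?thesis using v pathstart_in_path_image[of g] by (auto simp: drawn_def)
qed

lemma drawn_vertex:
  assumes "B \<subseteq> A" "sym B" "w \<in> fst ` A" "\<phi> w \<in> drawn B"
  shows "w \<in> fst ` B"
proof -
  obtain u v where "(u, v) \<in> B" "\<phi> w \<in> L {u, v}" using assms by (auto simp: drawn_def)
  then have "(u, v) \<in> B" "w \<in> {u, v}" using vertex_on_edge assms by auto
  moreover then have "(v, u) \<in> B" using assms by (auto dest: symD)
  ultimately show ?thesis by force
qed

text \<open>The edges of a path are joined one after the other; the drawing of an edge meets the rest of the path
  in the common end only.\<close>

lemma path_drawn_arc: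
  assumes "distinct p" "2 \<le> length p" "path_arcs p \<subseteq> A"
  shows "\<exists>g. arc g \<and> pathstart g = \<phi> (hd p) \<and> pathfinish g = \<phi> (last p) \<and> path_image g = drawn (path_arcs p)"
  using assms
proof (induction p rule: path_arcs.induct)
  case (1 x y zs)
  then obtain g where g: "arc g" "pathstart g = \<phi> x" "pathfinish g = \<phi> y" "path_image g = L {x, y}"
    using edge_arc[of x y] by auto
  have d: "drawn {(x, y), (y, x)} = L {x, y}" by (auto simp: drawn_def insert_commute)
  show ?case
  proof (cases zs)
    case Nil
    then show ?thesis using g d by (intro exI[of _ g]) auto
  next
    case (Cons z ws)
    then obtain h where h: "arc h" "pathstart h = \<phi> y" "pathfinish h = \<phi> (last (y # zs))"
      "path_image h = drawn (path_arcs (y # zs))"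
      using 1 by auto
    have "drawn {(x, y), (y, x)} \<inter> drawn (path_arcs (y # zs))
        \<subseteq> \<phi> ` (fst ` {(x, y), (y, x)} \<inter> fst ` path_arcs (y # zs))"
      using 1 path_arcs_subset[of "y # zs"] by (intro drawn_Int) (auto simp: sym_path_arcs sym_def dest: symD[OF sym_path_arcs])
    also have "\<dots> \<subseteq> {\<phi> y}" using 1(2) Cons by (subst fst_path_arcs) auto
    finally have i: "path_image g \<inter> path_image h \<subseteq> {\<phi> y}" using g h d by simp
    have "path_image (g +++ h) = drawn (path_arcs (x # y # zs))"
      using g h d by (simp add: path_image_join drawn_Un[symmetric])
        (simp add: drawn_def insert_commute)
    then show ?thesis using g h i by (intro exI[of _ "g +++ h"]) (auto intro!: arc_join)
  qed
qed auto

lemma drawn_Int_ends: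
  assumes "P \<subseteq> A" "Q \<subseteq> A" "sym P" "sym Q" "P \<inter> Q = {}" "fst ` P \<inter> fst ` Q = {a, b}"
  shows "drawn P \<inter> drawn Q = {\<phi> a, \<phi> b}"
proof -
  have "a \<in> fst ` P" "b \<in> fst ` P" "a \<in> fst ` Q" "b \<in> fst ` Q" using assms(6) by auto
  then show ?thesis
    using drawn_Int[OF assms(1-5)] assms(6) vertex_drawn[OF assms(1)] vertex_drawn[OF assms(2)]
    by (intro equalityI) (simp, meson IntI empty_subsetI insert_subset)
qed

text \<open>A list of all faces, each with a cycle that bounds it. The last two conditions are Euler's formula and
  the fact that every edge is on two faces. As arcs are counted in place of edges, the first of
  them appears multiplied by two. The face \<open>R\<close> is a component both of the complement of the whole
  drawing and of the complement of its own cycle: the second condition is what allows an ear in \<open>R\<close>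
  to be analysed by looking at three arcs only.\<close>

definition faces :: "'a rel \<Rightarrow> (complex set \<times> 'a list) list \<Rightarrow> bool" where
  "faces B Fs \<longleftrightarrow> sym B \<and> B \<subseteq> A \<and> finite B \<and>
     distinct (map fst Fs) \<and> - drawn B \<subseteq> \<Union> (fst ` set Fs) \<and>
     (\<forall>(R, C) \<in> set Fs. R \<in> components (- drawn B) \<and>
        cycle_in B C \<and> R \<in> components (- drawn (cycle_arcs C))) \<and>
     2 * length Fs + 2 * card (fst ` B) = card B + 4 \<and>
     (\<Sum>(R, C) \<leftarrow> Fs. length C) = card B"

text \<open>A cycle has two faces, the inside and the outside of a Jordan curve.\<close>

lemma faces_cycle:
  assumes C: "cycle_in A C"
  shows "\<exists>Fs. faces (cycle_arcs C) Fs"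
proof -
  let ?B = "cycle_arcs C"
  have C': "distinct C" "3 \<le> length C" "?B \<subseteq> A" using C by (auto simp: cycle_in_def)
  obtain a b ys where C2: "C = a # [] @ b # ys" "ys \<noteq> []" using two_paths_of_cycle[OF C'(1,2)] .
  let ?P = "path_arcs (a # [] @ [b])" and ?Q = "path_arcs (b # ys @ [a])"
  have B: "?B = ?P \<union> ?Q" unfolding C2(1) cycle_arcs_two_paths ..
  have dis: "?P \<inter> ?Q = {}" using two_paths_disjoint[of a "[]" b ys] C2 C'(1) by auto
  have "drawn ?P \<inter> drawn ?Q = {\<phi> a, \<phi> b}"
    using C'(3) B dis C2 C'(1) by (intro drawn_Int_ends sym_path_arcs) (auto simp: fst_path_arcs simp del: path_arcs.simps)
  moreover obtain g where g: "arc g" "pathstart g = \<phi> a" "pathfinish g = \<phi> b" "path_image g = drawn ?P"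
    using path_drawn_arc[of "a # [] @ [b]"] C'(1,3) C2 B by auto
  moreover obtain h where h: "arc h" "pathstart h = \<phi> a" "pathfinish h = \<phi> b" "path_image h = drawn ?Q"
    using path_drawn_arc[of "rev (b # ys @ [a])", unfolded path_arcs_rev] C'(1,3) C2 B by auto
  ultimately have "path_image g \<inter> path_image h = {\<phi> a, \<phi> b}" by simp
  note J = Jordan_curve_two_arcs[OF g(1-3) h(1-3) this]
  have dB: "path_image g \<union> path_image h = drawn ?B" unfolding B drawn_Un g h ..
  note J = J[unfolded dB]
  have ne: "inside (drawn ?B) \<noteq> outside (drawn ?B)" using J(3) inside_Int_outside[of "drawn ?B"] by (metis Int_absorb)
  have "faces ?B [(inside (drawn ?B), C), (outside (drawn ?B), C)]"
    unfolding faces_def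
    using C' C ne J(1) card_cycle_arcs[OF C'(1,2)] sym_cycle_arcs finite_cycle_arcs fst_cycle_arcs[of C] C2
      distinct_card[OF C'(1)]
    by (auto simp: cycle_in_def inside_Un_outside)
  then show ?thesis by blast
qed

text \<open>The interior of the ear is connected and avoids the drawing, hence it lies in one face \<open>R\<close>. The ends of
  the ear are limits of its interior, so they are on the cycle that bounds \<open>R\<close> and split it into two
  paths. Each of them forms a cycle with the ear, and \<open>arc_splits_component\<close> yields the two faces
  that replace \<open>R\<close>. An ear with \<open>n\<close> inner vertices adds \<open>n + 1\<close> edges and one face, and it adds
  \<open>2 (n + 1)\<close> to the total length of the boundary cycles.\<close>

lemma faces_ear:
  assumes F: "faces B Fs" and ab: "a \<in> fst ` B" "b \<in> fst ` B" "a \<noteq> b"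
    and q: "distinct q" "set q \<inter> fst ` B = {}"
    and p: "path_arcs (a # q @ [b]) \<subseteq> A" "path_arcs (a # q @ [b]) \<inter> B = {}"
  shows "\<exists>Fs'. faces (B \<union> path_arcs (a # q @ [b])) Fs'"
proof -
  let ?P = "path_arcs (a # q @ [b])"
  note F' = F[unfolded faces_def]
  have B: "sym B" "B \<subseteq> A" "finite B" and disF: "distinct (map fst Fs)"
    and cover: "- drawn B \<subseteq> \<Union> (fst ` set Fs)"
    and face: "\<And>R C. (R, C) \<in> set Fs \<Longrightarrow> R \<in> components (- drawn B) \<and>
        cycle_in B C \<and> R \<in> components (- drawn (cycle_arcs C))"
    and euler: "2 * length Fs + 2 * card (fst ` B) = card B + 4"
    and total: "(\<Sum>(R, C) \<leftarrow> Fs. length C) = card B"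
    using F' by auto
  have dp: "distinct (a # q @ [b])" using ab q by auto
  have fstP: "fst ` ?P = insert a (insert b (set q))" by (subst fst_path_arcs) auto
  have PB: "drawn ?P \<inter> drawn B = {\<phi> a, \<phi> b}"
    using p B ab q fstP by (intro drawn_Int_ends sym_path_arcs) auto
  obtain g where g: "arc g" "pathstart g = \<phi> a" "pathfinish g = \<phi> b" "path_image g = drawn ?P"
    using path_drawn_arc[OF dp _ p(1)] by auto
  let ?I = "drawn ?P - {\<phi> a, \<phi> b}"
  have I: "connected ?I" "?I \<noteq> {}" "?I \<subseteq> - drawn B"
    using connected_simple_path_endless[OF arc_imp_simple_path[OF g(1)]]
      nonempty_simple_path_endless[OF arc_imp_simple_path[OF g(1)]] g PB by auto
  obtain R C where RC: "(R, C) \<in> set Fs" "R \<inter> ?I \<noteq> {}" using I cover by fastforce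
  note fRC = face[OF RC(1)]
  have IR: "?I \<subseteq> R" using components_maximal[of R "- drawn B" ?I] fRC I RC(2) by auto
  have "drawn ?P \<subseteq> closure ?I"
  proof -
    have e: "?I = g ` {0<..<1}" using simple_path_endless[OF arc_imp_simple_path[OF g(1)]] g by simp
    have "g ` closure {0<..<1} \<subseteq> closure (g ` {0<..<1})"
      using g(1) by (intro image_closure_subset)
        (auto simp: arc_def path_def closure_subset closure_greaterThanLessThan)
    then show ?thesis using g(4) e by (simp add: path_image_def)
  qed
  then have cl: "\<phi> a \<in> closure R" "\<phi> b \<in> closure R" using PB closure_mono[OF IR] by auto
  have CB: "cycle_arcs C \<subseteq> B" "distinct C" "3 \<le> length C" using fRC by (auto simp: cycle_in_def)
  have RB: "R \<subseteq> - drawn B" using fRC in_components_subset by blast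
  have "frontier R \<subseteq> drawn (cycle_arcs C)"
    using fRC CB B closed_drawn[of "cycle_arcs C"] finite_cycle_arcs
    by (intro frontier_of_components_closed_complement) auto
  moreover have "\<phi> a \<notin> R" "\<phi> b \<notin> R" using RB PB by auto
  ultimately have "\<phi> a \<in> drawn (cycle_arcs C)" "\<phi> b \<in> drawn (cycle_arcs C)"
    using cl interior_subset by (auto simp: frontier_def)
  then have "a \<in> fst ` cycle_arcs C" "b \<in> fst ` cycle_arcs C"
    using drawn_vertex[of "cycle_arcs C"] CB B ab sym_cycle_arcs by (meson image_mono subset_iff order_trans)+
  then have "a \<in> set C" "b \<in> set C" using fst_cycle_arcs[of C] CB(3) by force+
  then obtain xs ys where split: "distinct (a # xs @ b # ys)" "length C = length xs + length ys + 2"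
    "cycle_arcs C = path_arcs (a # xs @ [b]) \<union> path_arcs (b # ys @ [a])"
    using cycle_split[OF CB(2)] ab(3) by metis
  let ?X = "path_arcs (a # xs @ [b])" and ?Y = "path_arcs (b # ys @ [a])"
  have XB: "?X \<subseteq> B" "?Y \<subseteq> B" using split(3) CB(1) by auto
  have XA: "?X \<subseteq> A" "?Y \<subseteq> A" using XB B by auto
  have fstX: "fst ` ?X = insert a (insert b (set xs))" "fst ` ?Y = insert a (insert b (set ys))"
    by (subst fst_path_arcs; auto)+
  have qxy: "set q \<inter> set xs = {}" "set q \<inter> set ys = {}"
    using q(2) fstX image_mono[OF XB(1), of fst] image_mono[OF XB(2), of fst] by auto
  have nonempty: "xs \<noteq> [] \<or> ys \<noteq> []" using split(2) CB(3) by auto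
  have XY: "?X \<inter> ?Y = {}" using two_paths_disjoint[OF split(1) nonempty] .
  have XP: "?X \<inter> ?P = {}" "?Y \<inter> ?P = {}" using XB p(2) by auto
  have dXY: "drawn ?X \<inter> drawn ?Y = {\<phi> a, \<phi> b}" using XA XY split(1) fstX
    by (intro drawn_Int_ends sym_path_arcs) auto
  have dXP: "drawn ?X \<inter> drawn ?P = {\<phi> a, \<phi> b}" using XA p(1) XP split(1) fstX fstP qxy ab
    by (intro drawn_Int_ends sym_path_arcs) auto
  have dYP: "drawn ?Y \<inter> drawn ?P = {\<phi> a, \<phi> b}" using XA p(1) XP split(1) fstX fstP qxy ab
    by (intro drawn_Int_ends sym_path_arcs) auto
  obtain g1 where g1: "arc g1" "pathstart g1 = \<phi> a" "pathfinish g1 = \<phi> b" "path_image g1 = drawn ?X"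
    using path_drawn_arc[of "a # xs @ [b]"] split(1) XA by auto
  obtain g2 where g2: "arc g2" "pathstart g2 = \<phi> a" "pathfinish g2 = \<phi> b" "path_image g2 = drawn ?Y"
    using path_drawn_arc[of "rev (b # ys @ [a])", unfolded path_arcs_rev] split(1) XA by auto
  have Rc: "R \<in> components (- (path_image g1 \<union> path_image g2))"
    using fRC split(3) g1 g2 by (simp add: drawn_Un)
  obtain R1 R2 where R12: "R1 \<in> components (- (drawn ?X \<union> drawn ?P))"
    "R2 \<in> components (- (drawn ?Y \<union> drawn ?P))" "R1 \<inter> R2 = {}" "R - drawn ?P = R1 \<union> R2"
    using arc_splits_component[OF g1(1-3) g2(1-3) g(1-3) _ _ _ Rc] dXY dXP dYP IR g(4) g1(4) g2(4) by auto
  define C1 where "C1 = a # xs @ b # rev q"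
  define C2 where "C2 = a # q @ b # ys"
  have arcsC1: "cycle_arcs C1 = ?X \<union> ?P"
    unfolding C1_def cycle_arcs_two_paths using path_arcs_rev[of "a # q @ [b]"] by simp
  have arcsC2: "cycle_arcs C2 = ?Y \<union> ?P"
    unfolding C2_def cycle_arcs_two_paths by auto
  \<comment> \<open>two parallel edges between \<open>a\<close> and \<open>b\<close> are excluded, so both new cycles have length at least three\<close>
  have no_double_edge: "xs \<noteq> [] \<or> q \<noteq> []" "ys \<noteq> [] \<or> q \<noteq> []" using XP by auto
  let ?B = "B \<union> ?P"
  have cyc: "cycle_in ?B C1" "cycle_in ?B C2"
    unfolding cycle_in_def using no_double_edge split(1) qxy q ab dp arcsC1 arcsC2 XB
    by (auto simp: C1_def C2_def Suc_le_eq numeral_eq_Suc)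
  have R12s: "R1 \<subseteq> - drawn ?B" "R2 \<subseteq> - drawn ?B"
    unfolding drawn_Un using RB R12(4) by blast+
  have comp: "R1 \<in> components (- drawn ?B)" "R2 \<in> components (- drawn ?B)"
    using drawn_mono[OF XB(1)] drawn_mono[OF XB(2)]
    by (intro components_intermediate_subset[OF R12(1) R12s(1)] components_intermediate_subset[OF R12(2) R12s(2)];
        auto simp: drawn_Un)+
  obtain Fs1 Fs2 where Fs: "Fs = Fs1 @ (R, C) # Fs2" using RC(1) by (auto simp: in_set_conv_decomp)
  have old: "R' \<in> components (- drawn ?B) \<and> cycle_in ?B C' \<and> R' \<in> components (- drawn (cycle_arcs C')) \<and> R' \<inter> R = {} \<and> R' \<noteq> {}"
    if RC': "(R', C') \<in> set (Fs1 @ Fs2)" for R' C'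
  proof -
    note fR' = face[of R' C']
    have "R' \<noteq> R" using RC' disF Fs by (auto simp: image_iff)
    then have dis: "R' \<inter> R = {}" using components_nonoverlap[of R' "- drawn B" R] fR' RC' fRC Fs by auto
    have sub: "R' \<subseteq> - drawn B" using fR' RC' Fs in_components_subset by auto
    have "drawn ?P \<subseteq> R \<union> drawn B" using IR PB by auto
    then have "R' \<inter> drawn ?P = {}" using dis sub by auto
    then have "R' \<in> components (- drawn ?B)"
      using components_intermediate_subset[of R' "- drawn B" "- drawn ?B"] fR' RC' Fs sub by (auto simp: drawn_Un)
    then show ?thesis using fR' RC' Fs dis in_components_nonempty by (auto simp: cycle_in_def)
  qed
  let ?Fs = "(R1, C1) # (R2, C2) # Fs1 @ Fs2"
  have ne12: "R1 \<noteq> {}" "R2 \<noteq> {}" using R12 in_components_nonempty by auto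
  have fresh: "R1 \<notin> fst ` set (Fs1 @ Fs2)" "R2 \<notin> fst ` set (Fs1 @ Fs2)"
    using old R12(4) ne12 by fastforce+
  have card_fst: "card (fst ` ?B) = card (fst ` B) + length q"
  proof -
    have "fst ` ?B = fst ` B \<union> set q" unfolding image_Un fstP using ab by auto
    then show ?thesis using q B by (simp add: card_Un_disjoint Int_commute distinct_card)
  qed
  have card_B: "card ?B = card B + 2 * (length q + 1)"
    using p(2) B(3) finite_path_arcs[of "a # q @ [b]"] card_path_arcs[OF dp] by (subst card_Un_disjoint) auto
  have "faces ?B ?Fs"
    unfolding faces_def
  proof (intro conjI)
    show "sym ?B" using B(1) sym_path_arcs by (rule sym_Un)
    show "?B \<subseteq> A" "finite ?B" using B p finite_path_arcs by auto
    show "distinct (map fst ?Fs)" using disF fresh R12(3) ne12 Fs by auto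
    show "- drawn ?B \<subseteq> \<Union> (fst ` set ?Fs)"
    proof
      fix z assume z: "z \<in> - drawn ?B"
      have "z \<in> - drawn B" "z \<notin> drawn ?P" using z unfolding drawn_Un by blast+
      then obtain R' where R': "R' \<in> fst ` set Fs" "z \<in> R'" using cover by blast
      show "z \<in> \<Union> (fst ` set ?Fs)"
      proof (cases "R' = R")
        case True
        then have "z \<in> R1 \<union> R2" using R12(4) R'(2) \<open>z \<notin> drawn ?P\<close> by blast
        then show ?thesis by auto
      next
        case False
        then have "R' \<in> fst ` set ?Fs" using R'(1) unfolding Fs by auto
        then show ?thesis using R'(2) by blast
      qed
    qed
    show "\<forall>(R, C) \<in> set ?Fs. R \<in> components (- drawn ?B) \<and>
        cycle_in ?B C \<and> R \<in> components (- drawn (cycle_arcs C))"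
      using comp cyc R12(1,2) arcsC1 arcsC2 old by (auto simp: drawn_Un)
    show "2 * length ?Fs + 2 * card (fst ` ?B) = card ?B + 4"
      using euler Fs card_fst card_B by simp
    show "(\<Sum>(R, C) \<leftarrow> ?Fs. length C) = card ?B"
      using total Fs card_B split(2) by (simp add: C1_def C2_def)
  qed
  then show ?thesis by blast
qed

text \<open>Every face has a boundary of length at least \<open>g\<close>; Euler's formula eliminates the number of faces.\<close>

lemma faces_girth:
  assumes F: "faces B Fs" and g: "\<And>C. cycle_in A C \<Longrightarrow> g \<le> length C"
  shows "g * card B + 4 * g \<le> 2 * card B + 2 * g * card (fst ` B)"
proof -
  have "\<forall>(R, C) \<in> set Fs. g \<le> length C"
    using F g by (fastforce simp: faces_def cycle_in_def)
  then have "g * length Fs \<le> (\<Sum>(R, C) \<leftarrow> Fs. length C)"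
    by (induction Fs) auto
  then have 1: "g * length Fs \<le> card B" using F by (simp add: faces_def)
  have "g * (2 * length Fs + 2 * card (fst ` B)) = g * (card B + 4)" using F by (simp add: faces_def)
  then have "g * card B + 4 * g = 2 * (g * length Fs) + 2 * g * card (fst ` B)"
    by (simp add: algebra_simps)
  then show ?thesis using 1 by linarith
qed

end

section \<open>Planar graphs of large girth are sparse\<close>

lemma rtrancl_path:
  assumes "(x, y) \<in> r\<^sup>*" "sym r"
  obtains p where "p \<noteq> []" "hd p = x" "last p = y" "distinct p" "path_arcs p \<subseteq> r" "set p \<subseteq> insert x (snd ` r)"
proof -
  from assms(1) have "\<exists>p. p \<noteq> [] \<and> hd p = x \<and> last p = y \<and> distinct p \<and> path_arcs p \<subseteq> r \<and> set p \<subseteq> insert x (snd ` r)"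
  proof induction
    case base
    then show ?case by (intro exI[of _ "[x]"]) auto
  next
    case (step y z)
    then obtain p where p: "p \<noteq> []" "hd p = x" "last p = y" "distinct p" "path_arcs p \<subseteq> r"
      "set p \<subseteq> insert x (snd ` r)" by auto
    show ?case
    proof (cases "z \<in> set p")
      case True
      then obtain p1 p2 where s: "p = p1 @ z # p2" by (auto simp: in_set_conv_decomp)
      then have "path_arcs (p1 @ [z]) \<subseteq> r" using p(5) path_arcs_append[of p1 z p2] by auto
      moreover have "hd (p1 @ [z]) = x" using p(2) s by (cases p1) auto
      ultimately show ?thesis using p s by (intro exI[of _ "p1 @ [z]"]) auto
    next
      case False
      then have "path_arcs (p @ [z]) \<subseteq> r"
        using p step(2) symD[OF assms(2)] by (auto simp: path_arcs_snoc)
      then show ?thesis using p False step(2) by (intro exI[of _ "p @ [z]"]) force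
    qed
  qed
  then show thesis using that by blast
qed

definition induced :: "'a rel \<Rightarrow> 'a set \<Rightarrow> 'a rel" where
  "induced A X = A \<inter> X \<times> X"

lemma card_induced_pair:
  assumes "irrefl A"
  shows "card (induced A {x, y}) \<le> 2"
proof -
  have "induced A {x, y} \<subseteq> {(x, y), (y, x)}"
    using assms by (auto simp: induced_def irrefl_def)
  then have "card (induced A {x, y}) \<le> card {(x, y), (y, x)}" by (intro card_mono) auto
  then show ?thesis by (simp add: card_insert_if split: if_splits)
qed

text \<open>There is no separation \<open>P, Q\<close> of order at most one with both parts proper. On at least three vertices,
  this is 2-connectedness.\<close>

definition nonseparable :: "'a rel \<Rightarrow> 'a set \<Rightarrow> bool" where
  "nonseparable A X \<longleftrightarrow> (\<forall>P Q. P \<union> Q = X \<longrightarrow> P \<noteq> X \<longrightarrow> Q \<noteq> X \<longrightarrow> card (P \<inter> Q) \<le> 1 \<longrightarrow>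
      (\<exists>u v. (u, v) \<in> A \<and> u \<in> P - Q \<and> v \<in> Q - P))"

text \<open>Let \<open>D\<close> be the set of vertices that can be reached outside \<open>Y\<close> from some vertex outside \<open>Y\<close>, and let
  \<open>N\<close> be the set of its neighbours in \<open>Y\<close>. If \<open>N\<close> had at most one element, then \<open>D \<union> N\<close> and \<open>X - D\<close>
  would be a forbidden separation. So two elements of \<open>N\<close> are joined by a path through \<open>D\<close>.\<close>

lemma nonseparable_ear:
  assumes "sym A" and X: "finite X" "nonseparable A X" and Y: "Y \<subseteq> X" "Y \<noteq> X" "2 \<le> card Y"
  obtains a b q where "a \<in> Y" "b \<in> Y" "a \<noteq> b" "q \<noteq> []" "distinct q" "set q \<subseteq> X - Y"
    "path_arcs (a # q @ [b]) \<subseteq> induced A X"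
proof -
  obtain v where v: "v \<in> X - Y" using Y by auto
  define r where "r = induced A (X - Y)"
  have r: "sym r" using \<open>sym A\<close> by (auto simp: r_def induced_def sym_def)
  define D where "D = {w. (v, w) \<in> r\<^sup>*}"
  have D: "v \<in> D" "D \<subseteq> X - Y"
  proof -
    have "w \<in> X - Y" if "(v, w) \<in> r\<^sup>*" for w
      using that v by induction (auto simp: r_def induced_def)
    then show "v \<in> D" "D \<subseteq> X - Y" by (auto simp: D_def)
  qed
  define N where "N = {y \<in> Y. \<exists>d \<in> D. (d, y) \<in> A}"
  have fin: "finite N" using X(1) Y(1) by (auto simp: N_def intro: finite_subset)
  have "\<not> card N \<le> 1"
  proof
    assume N1: "card N \<le> 1"
    have "N \<noteq> Y" using N1 Y(3) by auto
    then have "D \<union> N \<noteq> X" using D(2) Y(1) by (auto simp: N_def)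
    moreover have "(D \<union> N) \<union> (X - D) = X" "(D \<union> N) \<inter> (X - D) = N" "X - D \<noteq> X"
      using D Y v by (auto simp: N_def)
    ultimately obtain u w where uw: "(u, w) \<in> A" "u \<in> (D \<union> N) - (X - D)" "w \<in> (X - D) - (D \<union> N)"
      using X(2) N1 unfolding nonseparable_def by metis
    have "u \<in> D" using uw(2) Y D by (auto simp: N_def)
    then have "w \<notin> Y" using uw by (auto simp: N_def)
    then have "(u, w) \<in> r" using uw \<open>u \<in> D\<close> D by (auto simp: r_def induced_def)
    then have "w \<in> D" using \<open>u \<in> D\<close> rtrancl_into_rtrancl[of v u r w] by (auto simp: D_def)
    then show False using uw(3) by auto
  qed
  then obtain a b where ab: "a \<in> N" "b \<in> N" "a \<noteq> b"
    using fin by (metis One_nat_def card_le_Suc0_iff_eq)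
  then obtain d e where de: "d \<in> D" "(d, a) \<in> A" "e \<in> D" "(e, b) \<in> A" by (auto simp: N_def)
  have "(d, v) \<in> r\<^sup>*" using de(1) r by (auto simp: D_def intro: symD[OF sym_rtrancl])
  then have "(d, e) \<in> r\<^sup>*" using de(3) by (auto simp: D_def)
  then obtain q where q: "q \<noteq> []" "hd q = d" "last q = e" "distinct q" "path_arcs q \<subseteq> r"
    "set q \<subseteq> insert d (snd ` r)" using rtrancl_path r by metis
  have ds: "d \<in> X" "e \<in> X" "a \<in> X" "b \<in> X" using de D ab Y by (auto simp: N_def)
  have "path_arcs (a # q @ [b]) \<subseteq> induced A X"
    using q(1-3,5) de ds symD[OF \<open>sym A\<close>]
    by (auto simp: path_arcs_Cons path_arcs_snoc r_def induced_def)
  moreover have "set q \<subseteq> X - Y" using q(6) de D by (auto simp: r_def induced_def)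
  ultimately show thesis using that[of a b q] ab q by (auto simp: N_def)
qed

context plane_graph
begin

text \<open>Among the subgraphs with a list of faces, one with the largest number of arcs is the whole graph:
  otherwise an ear could be added, which is a single missing edge if all vertices are already present.\<close>

lemma nonseparable_sparse:
  assumes X: "finite X" "3 \<le> card X" "nonseparable A X"
    and irrefl: "irrefl A"
    and g: "\<And>C. cycle_in A C \<Longrightarrow> g \<le> length C"
  shows "g * card (induced A X) + 4 * g \<le> 2 * card (induced A X) + 2 * g * card X"
proof -
  let ?E = "induced A X"
  have finE: "finite ?E" using X(1) by (auto simp: induced_def)
  have symE: "sym ?E" using sym_A by (auto simp: induced_def sym_def)
  have EA: "?E \<subseteq> A" by (auto simp: induced_def)
  let ?ok = "\<lambda>B. B \<subseteq> ?E \<and> (\<exists>Fs. faces B Fs)"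
  \<comment> \<open>an ear on the two ends of an edge, together with this edge, is a cycle\<close>
  have start: "\<exists>C. cycle_in ?E C"
  proof -
    obtain x where x: "x \<in> X" using X(2) by fastforce
    have "X \<noteq> {x}" using X(2) by auto
    moreover have "{x} \<union> (X - {x}) = X" "X - {x} \<noteq> X" "card ({x} \<inter> (X - {x})) \<le> 1" using x by auto
    ultimately obtain y where y: "(x, y) \<in> A" "y \<in> X" "y \<noteq> x"
      using X(3) unfolding nonseparable_def by (metis Diff_iff singletonD singletonI)
    have "{x, y} \<subseteq> X" "{x, y} \<noteq> X" "2 \<le> card {x, y}" using x y X(2) by (auto simp: card_insert_if)
    then obtain a b q where q: "a \<in> {x, y}" "b \<in> {x, y}" "a \<noteq> b" "q \<noteq> []" "distinct q" "set q \<subseteq> X - {x, y}"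
      "path_arcs (a # q @ [b]) \<subseteq> ?E"
      using nonseparable_ear[OF sym_A X(1,3)] by metis
    have "(a, b) \<in> ?E" "(b, a) \<in> ?E" using q(1-3) x y symD[OF sym_A y(1)] by (auto simp: induced_def)
    then have "cycle_arcs (a # q @ b # []) \<subseteq> ?E" using q(7) unfolding cycle_arcs_two_paths by auto
    moreover have "distinct (a # q @ [b])" using q by auto
    ultimately have "cycle_in ?E (a # q @ [b])" using q(4) by (auto simp: cycle_in_def Suc_le_eq)
    then show ?thesis ..
  qed
  then obtain C where C: "cycle_in ?E C" ..
  then have "cycle_in A C" using EA by (auto simp: cycle_in_def)
  then have okC: "?ok (cycle_arcs C)" using faces_cycle C by (auto simp: cycle_in_def)
  have "\<exists>B. ?ok B \<and> (\<forall>B'. ?ok B' \<longrightarrow> card B' \<le> card B)"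
    using okC finE by (intro ex_has_greatest_nat[of ?ok _ card "Suc (card ?E)"])
      (auto intro!: card_mono simp: less_Suc_eq_le)
  then obtain B Fs where B: "B \<subseteq> ?E" "faces B Fs" and max: "\<And>B'. ?ok B' \<Longrightarrow> card B' \<le> card B" by auto
  have finB: "finite B" "sym B" using B(2) by (auto simp: faces_def)
  have no_ear: "path_arcs (a # q @ [b]) \<inter> B \<noteq> {}"
    if "a \<in> fst ` B" "b \<in> fst ` B" "a \<noteq> b" "distinct q" "set q \<inter> fst ` B = {}" "path_arcs (a # q @ [b]) \<subseteq> ?E" for a b q
  proof
    assume dis: "path_arcs (a # q @ [b]) \<inter> B = {}"
    then have "?ok (B \<union> path_arcs (a # q @ [b]))"
      using faces_ear[OF B(2), of a b q] that B(1) EA by auto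
    then have "card (B \<union> path_arcs (a # q @ [b])) \<le> card B" by (rule max)
    moreover have "distinct (a # q @ [b])" using that by auto
    ultimately show False using dis finB finite_path_arcs[of "a # q @ [b]"] card_path_arcs[of "a # q @ [b]"]
      by (subst (asm) card_Un_disjoint) auto
  qed
  have "B \<noteq> {}" using okC max[OF okC] C by (auto simp: cycle_in_def card_cycle_arcs)
  then obtain u v where uv: "(u, v) \<in> B" by auto
  then have "u \<noteq> v" "(v, u) \<in> B" using B(1) EA irrefl finB by (auto simp: irrefl_def dest: symD)
  then have "{u, v} \<subseteq> fst ` B" using uv by force
  then have "2 \<le> card (fst ` B)" using card_mono[of "fst ` B" "{u, v}"] finB \<open>u \<noteq> v\<close> by simp
  moreover have sub: "fst ` B \<subseteq> X" using B(1) by (auto simp: induced_def)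
  ultimately have fB: "fst ` B = X"
  proof (rule_tac ccontr)
    assume "2 \<le> card (fst ` B)" "fst ` B \<subseteq> X" "fst ` B \<noteq> X"
    then obtain a b q where q: "a \<in> fst ` B" "b \<in> fst ` B" "a \<noteq> b" "q \<noteq> []" "distinct q" "set q \<subseteq> X - fst ` B"
      "path_arcs (a # q @ [b]) \<subseteq> ?E"
      using nonseparable_ear[OF sym_A X(1,3)] by metis
    have "(u, v) \<notin> B" if uv: "(u, v) \<in> path_arcs (a # q @ [b])" for u v
    proof
      assume uvB: "(u, v) \<in> B"
      then have "u \<notin> set q" "v \<notin> set q" using q(6) symD[OF finB(2) uvB] by force+
      moreover have "u \<in> set q \<or> v \<in> set q"
        using uv q(1,3,4) path_arcs_subset[of q] by (auto simp: path_arcs_Cons path_arcs_snoc)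
      ultimately show False by auto
    qed
    then have "path_arcs (a # q @ [b]) \<inter> B = {}" by (metis disjoint_iff surj_pair)
    moreover have "set q \<inter> fst ` B = {}" using q(6) by blast
    ultimately show False using no_ear[OF q(1-3,5) _ q(7)] by blast
  qed
  have "B = ?E"
  proof (rule ccontr)
    assume "B \<noteq> ?E"
    then obtain a b where ab: "(a, b) \<in> ?E" "(a, b) \<notin> B" using B(1) by auto
    then have "(b, a) \<in> ?E" "(b, a) \<notin> B" "a \<noteq> b" "a \<in> X" "b \<in> X"
      using symE finB irrefl by (auto simp: induced_def irrefl_def dest: symD)
    then show False using no_ear[of a b "[]"] ab fB by auto
  qed
  then show ?thesis using faces_girth[OF B(2) g] fB by simp
qed

text \<open>In terms of the number \<open>e\<close> of edges and \<open>n\<close> of vertices, the claim is \<open>(g - 2) e \<le> g (n - 1)\<close>. In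
  contrast to the stronger \<open>(g - 2) e \<le> g (n - 2)\<close> from Euler's formula, it holds for one and two vertices
  as well, and it is preserved when two graphs are glued together at one vertex.\<close>

theorem plane_graph_sparse:
  assumes "finite X" "X \<noteq> {}" and irrefl: "irrefl A"
    and g: "\<And>C. cycle_in A C \<Longrightarrow> g \<le> length C" and "2 \<le> g"
  shows "g * card (induced A X) + 2 * g \<le> 2 * card (induced A X) + 2 * g * card X"
  using assms(1,2)
proof (induction "card X" arbitrary: X rule: less_induct)
  case less
  obtain h where h: "g = h + 2" using \<open>2 \<le> g\<close> by (metis add.commute le_Suc_ex)
  show ?case
  proof (cases "nonseparable A X")
    case False
    then obtain P Q where PQ: "P \<union> Q = X" "P \<noteq> X" "Q \<noteq> X" "card (P \<inter> Q) \<le> 1"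
      and sep: "\<And>u v. (u, v) \<in> A \<Longrightarrow> u \<in> P - Q \<Longrightarrow> v \<notin> Q - P"
      unfolding nonseparable_def by auto
    have "P \<subset> X" "Q \<subset> X" "P \<noteq> {}" "Q \<noteq> {}" using PQ by auto
    then have fin: "finite P" "finite Q" and "card P < card X" "card Q < card X"
      using less.prems by (auto intro: finite_subset psubset_card_mono)
    then have IH: "g * card (induced A P) + 2 * g \<le> 2 * card (induced A P) + 2 * g * card P"
      "g * card (induced A Q) + 2 * g \<le> 2 * card (induced A Q) + 2 * g * card Q"
      using less.hyps \<open>P \<noteq> {}\<close> \<open>Q \<noteq> {}\<close> by auto
    have "induced A X \<subseteq> induced A P \<union> induced A Q"
    proof
      fix e assume "e \<in> induced A X"
      then obtain u v where e: "e = (u, v)" "(u, v) \<in> A" "u \<in> X" "v \<in> X" by (auto simp: induced_def)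
      then show "e \<in> induced A P \<union> induced A Q"
        using sep[of u v] sep[of v u] symD[OF sym_A e(2)] PQ(1) by (auto simp: induced_def)
    qed
    then have "card (induced A X) \<le> card (induced A P \<union> induced A Q)"
      using fin by (intro card_mono) (auto simp: induced_def)
    also have "\<dots> \<le> card (induced A P) + card (induced A Q)" by (rule card_Un_le)
    finally have c: "card (induced A X) \<le> card (induced A P) + card (induced A Q)" .
    have "card P + card Q = card X + card (P \<inter> Q)" using card_Un_Int[OF fin] PQ(1) by simp
    then have n: "card P + card Q \<le> card X + 1" using PQ(4) by simp
    have "h * card (induced A X) \<le> h * card (induced A P) + h * card (induced A Q)"
      using mult_le_mono2[OF c, of h] by (simp add: algebra_simps)
    moreover have "g * card P + g * card Q \<le> g * card X + g"
      using mult_le_mono2[OF n, of g] by (simp add: algebra_simps)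
    ultimately show ?thesis using IH unfolding h by (simp add: algebra_simps)
  next
    case True
    consider "card X = 1" | "card X = 2" | "3 \<le> card X"
      using less.prems by (metis One_nat_def Suc_1 card_gt_0_iff le_neq_implies_less less_eq_Suc_le numeral_3_eq_3)
    then show ?thesis
    proof cases
      case 1
      then obtain x where "X = {x}" by (auto simp: card_1_singleton_iff)
      then have "induced A X = {}" using irrefl by (auto simp: induced_def irrefl_def)
      then show ?thesis using 1 by simp
    next
      case 2
      then obtain x y where "X = {x, y}" by (auto simp: card_2_iff)
      then have "card (induced A X) \<le> 2" using card_induced_pair[OF irrefl] by simp
      then have "h * card (induced A X) \<le> h * 2" by (rule mult_le_mono2)
      moreover have "m \<le> h * 2 \<Longrightarrow> m + 2 * c + 2 * (h + 2) \<le> 2 * c + 2 * (h + 2) * 2" for m c :: nat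
        by presburger
      ultimately show ?thesis unfolding h 2 add_mult_distrib by blast
    next
      case 3
      then show ?thesis using nonseparable_sparse[OF less.prems(1) 3 True irrefl g] by simp
    qed
  qed
qed

end

section \<open>Odd colour classes\<close>

definition nbrs_in :: "'a rel \<Rightarrow> 'a set \<Rightarrow> 'a \<Rightarrow> 'a set" where
  "nbrs_in A X v = {u \<in> X. (v, u) \<in> A}"

definition odd_classes :: "('a \<Rightarrow> nat) \<Rightarrow> 'a set \<Rightarrow> bool" where
  "odd_classes c N \<longleftrightarrow> (\<forall>i \<in> c ` N. odd (card {u \<in> N. c u = i}))"

text \<open>Only induced subgraphs occur in the induction. They are given by their vertex set \<open>X\<close> alone, with the
  arcs \<open>A\<close> of the whole graph fixed.\<close>

definition strong_odd_on :: "'a rel \<Rightarrow> 'a set \<Rightarrow> nat \<Rightarrow> ('a \<Rightarrow> nat) \<Rightarrow> bool" where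
  "strong_odd_on A X k c \<longleftrightarrow> (\<forall>v \<in> X. c v \<in> {1..k}) \<and> (\<forall>v \<in> X. \<forall>u \<in> nbrs_in A X v. c v \<noteq> c u) \<and>
     (\<forall>v \<in> X. odd_classes c (nbrs_in A X v))"

text \<open>The colours that an uncoloured neighbour of \<open>v\<close> has to avoid on account of \<open>v\<close>: it must differ from
  \<open>v\<close>, and a colour that is new in the neighbourhood of \<open>v\<close> leaves the other colour classes there
  unchanged.\<close>

definition blocked :: "'a rel \<Rightarrow> 'a set \<Rightarrow> ('a \<Rightarrow> nat) \<Rightarrow> 'a \<Rightarrow> nat set" where
  "blocked A X c v = insert (c v) (c ` nbrs_in A X v)"

lemma odd_classes_inj: "inj_on c N \<Longrightarrow> odd_classes c N"
  unfolding odd_classes_def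
proof
  fix i assume "inj_on c N" "i \<in> c ` N"
  then obtain u where "u \<in> N" "{u' \<in> N. c u' = i} = {u}" by (auto dest: inj_onD)
  then show "odd (card {u \<in> N. c u = i})" by simp
qed

lemma odd_classes_two: "c p \<noteq> c q \<Longrightarrow> odd_classes c {p, q}"
  by (rule odd_classes_inj) (auto simp: inj_on_def)

lemma odd_classes_three: "c p \<noteq> c q \<Longrightarrow> c p \<noteq> c r \<Longrightarrow> c q \<noteq> c r \<Longrightarrow> odd_classes c {p, q, r}"
  by (rule odd_classes_inj) (auto simp: inj_on_def)

lemma odd_classes_cong: "(\<And>u. u \<in> N \<Longrightarrow> c u = c' u) \<Longrightarrow> odd_classes c N \<longleftrightarrow> odd_classes c' N"
proof -
  assume eq: "\<And>u. u \<in> N \<Longrightarrow> c u = c' u"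
  then have "{u \<in> N. c u = i} = {u \<in> N. c' u = i}" for i by auto
  moreover have "c ` N = c' ` N" using eq by (rule image_cong[OF refl])
  ultimately show ?thesis unfolding odd_classes_def by simp
qed

lemma odd_classes_insert:
  assumes "odd_classes c N" "c s \<notin> c ` N"
  shows "odd_classes c (insert s N)"
  unfolding odd_classes_def
proof
  fix i assume i: "i \<in> c ` insert s N"
  show "odd (card {u \<in> insert s N. c u = i})"
  proof (cases "i = c s")
    case True
    then have "{u \<in> insert s N. c u = i} = {s}" using assms(2) by (auto simp: image_iff)
    then show ?thesis by simp
  next
    case False
    then have "{u \<in> insert s N. c u = i} = {u \<in> N. c u = i}" by auto
    then show ?thesis using assms(1) False i by (auto simp: odd_classes_def)
  qed
qed

lemma odd_classes_triple:
  assumes "p \<in> N" "q \<in> N" "r \<in> N" "p \<noteq> q" "p \<noteq> r" "q \<noteq> r" "c p = c r" "c q = c r"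
    and inj: "inj_on c (N - {p, q})"
  shows "odd_classes c N"
  unfolding odd_classes_def
proof
  fix i assume i: "i \<in> c ` N"
  show "odd (card {u \<in> N. c u = i})"
  proof (cases "i = c r")
    case True
    then have "{u \<in> N. c u = i} = {p, q, r}" using assms by (auto dest: inj_onD[OF inj])
    then show ?thesis using assms by simp
  next
    case False
    then obtain u where u: "u \<in> N - {p, q}" "i = c u" using i assms by auto
    have "x = u" if "x \<in> N" "c x = c u" for x
    proof -
      have "x \<noteq> p" "x \<noteq> q" using that(2) False u(2) assms(7,8) by auto
      then show ?thesis using inj_onD[OF inj that(2)] that(1) u(1) by simp
    qed
    then have "{u' \<in> N. c u' = i} = {u}" using u by auto
    then show ?thesis by simp
  qed
qed

text \<open>Together with one more element of colour \<open>t\<close>, all colour classes of \<open>f\<close> on \<open>I\<close> are singletons, except that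
  \<open>t\<close> may occur three times.\<close>

definition repeats_oddly :: "('a \<Rightarrow> nat) \<Rightarrow> 'a set \<Rightarrow> nat \<Rightarrow> bool" where
  "repeats_oddly f I t \<longleftrightarrow> inj_on f I \<and> t \<notin> f ` I \<or>
     (\<exists>i \<in> I. \<exists>j \<in> I. i \<noteq> j \<and> f i = t \<and> f j = t \<and> inj_on f (I - {i, j}) \<and> t \<notin> f ` (I - {i, j}))"

lemma odd_classes_insert_repeated:
  assumes y: "y \<notin> V" and cV: "\<And>v. v \<in> V \<Longrightarrow> c v = f v"
    and f: "repeats_oddly f V (c y)"
  shows "odd_classes c (insert y V)"
proof -
  have ins: "inj_on c (insert y W)" if W: "W \<subseteq> V" "inj_on f W" "c y \<notin> f ` W" for W
  proof -
    have "inj_on c W" using W(1,2) cV by (auto simp: inj_on_def subset_iff)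
    moreover have "c ` W = f ` W" using W(1) cV by (auto simp: image_iff subset_iff)
    ultimately show ?thesis using W(3) by auto
  qed
  from f[unfolded repeats_oddly_def] show ?thesis
  proof (elim disjE bexE conjE)
    assume "inj_on f V" "c y \<notin> f ` V"
    then show ?thesis using ins[of V] by (auto intro: odd_classes_inj)
  next
    fix i j assume ij: "i \<in> V" "j \<in> V" "i \<noteq> j" "f i = c y" "f j = c y"
      "inj_on f (V - {i, j})" "c y \<notin> f ` (V - {i, j})"
    have "insert y V - {i, j} = insert y (V - {i, j})" using ij(1,2) y by auto
    then have "inj_on c (insert y V - {i, j})" using ins[of "V - {i, j}"] ij(6,7) by auto
    then show ?thesis using ij(1-5) cV[OF ij(1)] cV[OF ij(2)] y
      by (intro odd_classes_triple[of i "insert y V" j y]) auto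
  qed
qed

lemma pick_color: "finite F \<Longrightarrow> card F < k \<Longrightarrow> \<exists>i \<in> {1..k}. i \<notin> (F :: nat set)"
  using card_mono[of F "{1..k}"] by fastforce

lemma card_free_colors:
  assumes "finite F" "card F + m \<le> k"
  shows "m \<le> card ({1..k} - (F :: nat set))"
  using diff_card_le_card_Diff[of F "{1..k}"] assms by simp

lemma distinct_choice:
  assumes "finite I" "\<And>i. i \<in> I \<Longrightarrow> card I \<le> card (Lst i)"
  obtains f where "inj_on f I" "\<And>i. i \<in> I \<Longrightarrow> f i \<in> Lst i"
proof -
  have "\<exists>f. inj_on f I \<and> (\<forall>i \<in> I. f i \<in> Lst i)"
    using assms
  proof (induction I arbitrary: Lst rule: finite_induct)
    case empty then show ?case by auto
  next
    case (insert i I)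
    have "Lst i \<noteq> {}" using insert.hyps insert.prems[of i] by auto
    then obtain x where x: "x \<in> Lst i" by auto
    have "card I \<le> card (Lst j - {x})" if "j \<in> I" for j
      using insert.prems[of j] insert.hyps that by (auto simp: card_Diff_singleton_if)
    from insert.IH[of "\<lambda>j. Lst j - {x}", OF this] obtain f where
      "inj_on f I" "\<forall>j \<in> I. f j \<in> Lst j - {x}" by auto
    then show ?case using x insert.hyps
      by (intro exI[of _ "f(i := x)"]) (auto simp: inj_on_def)
  qed
  then show thesis using that by auto
qed

text \<open>If \<open>t\<close> is in two of the lists, it is used for both, and the other elements get different colours by
  distinct choice, with two spare colours of which \<open>t\<close> takes one. If \<open>t\<close> is in one list only, this list
  has another colour; choosing it first, distinct choice for the rest never meets \<open>t\<close>. So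
  lists of size \<open>card I\<close> (and at least 2) suffice, whereas avoiding \<open>t\<close> altogether may need
  one more colour in each.\<close>

lemma odd_choice:
  assumes I: "finite I" and big: "\<And>i. i \<in> I \<Longrightarrow> max 2 (card I) \<le> card (Lst i)"
  obtains f where "\<And>i. i \<in> I \<Longrightarrow> f i \<in> Lst i" "repeats_oddly f I t"
proof (cases "\<exists>i \<in> I. \<exists>j \<in> I. i \<noteq> j \<and> t \<in> Lst i \<and> t \<in> Lst j")
  case True
  then obtain i j where ij: "i \<in> I" "j \<in> I" "i \<noteq> j" "t \<in> Lst i" "t \<in> Lst j" by auto
  let ?J = "I - {i, j}"
  have c: "card ?J = card I - 2" using ij I by (simp add: card_Diff_subset)
  have "card ?J \<le> card (Lst l - {t})" if "l \<in> ?J" for l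
    using big[of l] that c by (auto simp: card_Diff_singleton_if)
  then obtain f where f: "inj_on f ?J" "\<And>l. l \<in> ?J \<Longrightarrow> f l \<in> Lst l - {t}"
    using distinct_choice[of ?J "\<lambda>l. Lst l - {t}"] I by (metis finite_Diff)
  let ?f = "f(i := t, j := t)"
  have on_J: "?f l = f l" if "l \<in> ?J" for l using that by simp
  have "inj_on ?f ?J" using f(1) inj_on_cong[of ?J ?f f] on_J by blast
  moreover have "t \<notin> ?f ` ?J" using f(2) on_J by (metis DiffD2 imageE singletonI)
  moreover have "?f i = t" "?f j = t" by simp_all
  ultimately have "repeats_oddly ?f I t" unfolding repeats_oddly_def using ij(1-3) by blast
  moreover have "?f l \<in> Lst l" if "l \<in> I" for l
    using f(2)[of l] ij(4,5) that by simp
  ultimately show thesis using that(1) by blast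
next
  case no_pair: False
  show thesis
  proof (cases "\<exists>i \<in> I. t \<in> Lst i")
    case True
    then obtain i where i: "i \<in> I" "t \<in> Lst i" by auto
    have "card (Lst i - {t}) \<noteq> 0" using big[OF i(1)] i by (auto simp: card_Diff_singleton_if)
    then have "Lst i - {t} \<noteq> {}" by (metis card.empty)
    then obtain x where x: "x \<in> Lst i" "x \<noteq> t" by blast
    have "card (I - {i}) \<le> card (Lst l - {x})" if "l \<in> I - {i}" for l
      using big[of l] that i I by (auto simp: card_Diff_singleton_if)
    then obtain f where f: "inj_on f (I - {i})" "\<And>l. l \<in> I - {i} \<Longrightarrow> f l \<in> Lst l - {x}"
      using distinct_choice[of "I - {i}" "\<lambda>l. Lst l - {x}"] I by (metis finite_Diff)
    let ?f = "f(i := x)"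
    have "inj_on ?f I" using f by (auto simp: inj_on_def)
    moreover have "?f l \<noteq> t" if "l \<in> I" for l
      using f(2)[of l] x(2) no_pair i that by (cases "l = i") auto
    ultimately have "repeats_oddly ?f I t" unfolding repeats_oddly_def by blast
    moreover have "?f l \<in> Lst l" if "l \<in> I" for l using f(2)[of l] x(1) that by simp
    ultimately show thesis using that(1) by blast
  next
    case False
    have "card I \<le> card (Lst l)" if "l \<in> I" for l using big[OF that] by simp
    then obtain f where f: "inj_on f I" "\<And>l. l \<in> I \<Longrightarrow> f l \<in> Lst l" using distinct_choice I by metis
    then have "repeats_oddly f I t" unfolding repeats_oddly_def using False by blast
    then show thesis using that(1) f(2) by blast
  qed
qed

section \<open>Reducible configurations\<close>

locale girth7 =
  fixes A :: "'a rel"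
  assumes sym_A: "sym A" and irrefl_A: "irrefl A"
    and girth_A: "cycle_in A C \<Longrightarrow> 7 \<le> length C"
begin

lemma adj_sym: "(u, v) \<in> A \<Longrightarrow> (v, u) \<in> A"
  using sym_A by (auto dest: symD)

lemma adj_neq: "(u, v) \<in> A \<Longrightarrow> u \<noteq> v"
  using irrefl_A by (auto simp: irrefl_def)

lemma no_cycle3: "(a, b) \<in> A \<Longrightarrow> (b, c) \<in> A \<Longrightarrow> (c, a) \<in> A \<Longrightarrow> False"
  using girth_A[of "[a, b, c]"] adj_neq[of a b] adj_neq[of b c] adj_neq[of c a]
  by (auto simp: cycle_in_def cycle_arcs_def dest: adj_sym)

lemma no_cycle4:
  "(a, b) \<in> A \<Longrightarrow> (b, c) \<in> A \<Longrightarrow> (c, d) \<in> A \<Longrightarrow> (d, a) \<in> A \<Longrightarrow> a \<noteq> c \<Longrightarrow> b \<noteq> d \<Longrightarrow> False"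
  using girth_A[of "[a, b, c, d]"] adj_neq[of a b] adj_neq[of b c] adj_neq[of c d] adj_neq[of d a]
  by (auto simp: cycle_in_def cycle_arcs_def dest: adj_sym)

text \<open>Distinct vertices come for free, since a closed walk of length five that repeats a vertex contains a
  triangle.\<close>

lemma no_cycle5:
  assumes "(a, b) \<in> A" "(b, c) \<in> A" "(c, d) \<in> A" "(d, e) \<in> A" "(e, a) \<in> A"
  shows False
proof -
  have "a \<noteq> c" using no_cycle3[of a d e] assms by auto
  moreover have "b \<noteq> d" using no_cycle3[of a b e] assms by auto
  moreover have "c \<noteq> e" using no_cycle3[of a b c] assms by auto
  moreover have "d \<noteq> a" using no_cycle3[of a b c] assms by auto
  moreover have "e \<noteq> b" using no_cycle3[of b c d] assms by auto
  ultimately show False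
    using girth_A[of "[a, b, c, d, e]"] assms adj_neq[of a b] adj_neq[of b c] adj_neq[of c d]
      adj_neq[of d e] adj_neq[of e a] adj_sym
    by (auto simp: cycle_in_def cycle_arcs_def)
qed

lemma no_cycle6:
  assumes "(a, b) \<in> A" "(b, c) \<in> A" "(c, d) \<in> A" "(d, e) \<in> A" "(e, f) \<in> A" "(f, a) \<in> A"
    and "a \<noteq> c" "b \<noteq> d" "c \<noteq> e" "d \<noteq> f" "e \<noteq> a" "f \<noteq> b"
  shows False
proof -
  have "a \<noteq> d" using no_cycle3[of a b c] assms by auto
  moreover have "b \<noteq> e" using no_cycle3[of b c d] assms by auto
  moreover have "c \<noteq> f" using no_cycle3[of c d e] assms by auto
  ultimately show False
    using girth_A[of "[a, b, c, d, e, f]"] assms adj_neq[of a b] adj_neq[of b c] adj_neq[of c d]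
      adj_neq[of d e] adj_neq[of e f] adj_neq[of f a] adj_sym
    by (auto simp: cycle_in_def cycle_arcs_def)
qed

text \<open>A vertex \<open>v\<close> outside \<open>S\<close> gains at most one neighbour \<open>s\<close>, whose colour is new around \<open>v\<close>. In the
  applications \<open>S\<close> is a small tree, and a vertex with two neighbours in \<open>S\<close> would close a
  cycle of length less than seven.\<close>

lemma strong_odd_on_extend:
  assumes "S \<subseteq> X" and c: "strong_odd_on A (X - S) k c"
    and one: "\<And>v s t. v \<in> X - S \<Longrightarrow> s \<in> S \<Longrightarrow> t \<in> S \<Longrightarrow> (v, s) \<in> A \<Longrightarrow> (v, t) \<in> A \<Longrightarrow> s = t"
    and rng: "\<And>s. s \<in> S \<Longrightarrow> f s \<in> {1..k}"
    and avoid: "\<And>s v. s \<in> S \<Longrightarrow> v \<in> X - S \<Longrightarrow> (s, v) \<in> A \<Longrightarrow> f s \<notin> blocked A (X - S) c v"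
    and distinct_S: "\<And>s t. s \<in> S \<Longrightarrow> t \<in> S \<Longrightarrow> (s, t) \<in> A \<Longrightarrow> f s \<noteq> f t"
    and par: "\<And>s. s \<in> S \<Longrightarrow> odd_classes (override_on c f S) (nbrs_in A X s)"
  shows "strong_odd_on A X k (override_on c f S)"
proof -
  let ?c = "override_on c f S"
  have cS: "?c s = f s" if "s \<in> S" for s using that by simp
  have cX: "?c v = c v" if "v \<notin> S" for v using that by simp
  have "?c v \<in> {1..k}" if "v \<in> X" for v
    using that rng c by (cases "v \<in> S") (auto simp: strong_odd_on_def)
  moreover have "?c v \<noteq> ?c u" if uv: "v \<in> X" "u \<in> nbrs_in A X v" for u v
  proof -
    have a: "(v, u) \<in> A" "(u, v) \<in> A" "u \<in> X" using uv adj_sym[of v u] by (simp_all add: nbrs_in_def)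
    consider "v \<in> S" "u \<in> S" | "v \<in> S" "u \<notin> S" | "v \<notin> S" "u \<in> S" | "v \<notin> S" "u \<notin> S" by auto
    then show ?thesis
    proof cases
      case 1 then show ?thesis using distinct_S a by simp
    next
      case 2 then show ?thesis using avoid[of v u] a by (auto simp: blocked_def)
    next
      case 3 then show ?thesis using avoid[of u v] a uv by (auto simp: blocked_def)
    next
      case 4 then show ?thesis using c a uv by (auto simp: strong_odd_on_def nbrs_in_def)
    qed
  qed
  moreover have "odd_classes ?c (nbrs_in A X v)" if v: "v \<in> X" for v
  proof (cases "v \<in> S")
    case True then show ?thesis by (rule par)
  next
    case vS: False
    have "odd_classes c (nbrs_in A (X - S) v)" using c v vS by (auto simp: strong_odd_on_def)
    then have old: "odd_classes ?c (nbrs_in A (X - S) v)"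
      using odd_classes_cong[of "nbrs_in A (X - S) v" ?c c] by (auto simp: nbrs_in_def)
    show ?thesis
    proof (cases "\<exists>s \<in> S. (v, s) \<in> A")
      case True
      then obtain s where s: "s \<in> S" "(v, s) \<in> A" by auto
      have vXS: "v \<in> X - S" using v vS by (rule DiffI)
      have e: "nbrs_in A X v = insert s (nbrs_in A (X - S) v)"
      proof (intro equalityI subsetI)
        fix u assume "u \<in> nbrs_in A X v"
        then have u: "u \<in> X" "(v, u) \<in> A" by (simp_all add: nbrs_in_def)
        show "u \<in> insert s (nbrs_in A (X - S) v)"
        proof (cases "u \<in> S")
          case True
          then have "u = s" by (rule one[OF vXS _ s(1) u(2) s(2)])
          then show ?thesis by simp
        next
          case False
          then show ?thesis using u by (simp add: nbrs_in_def)
        qed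
      next
        fix u assume "u \<in> insert s (nbrs_in A (X - S) v)"
        then show "u \<in> nbrs_in A X v" using s \<open>S \<subseteq> X\<close> by (auto simp: nbrs_in_def)
      qed
      have "f s \<notin> blocked A (X - S) c v" using avoid[of s v] s v vS adj_sym[OF s(2)] by simp
      then have "?c s \<notin> ?c ` nbrs_in A (X - S) v"
        using s by (auto simp: blocked_def nbrs_in_def override_on_def image_iff)
      then show ?thesis unfolding e using old by (intro odd_classes_insert)
    next
      case False
      then have "nbrs_in A X v = nbrs_in A (X - S) v" by (auto simp: nbrs_in_def)
      then show ?thesis using old by simp
    qed
  qed
  ultimately show ?thesis unfolding strong_odd_on_def by auto
qed

text \<open>The uncoloured neighbour \<open>s\<close> of \<open>v\<close> makes up for \<open>v\<close> itself.\<close>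

lemma blocked_card:
  assumes "finite X" "S \<subseteq> X" "v \<in> X - S" "s \<in> S" "(s, v) \<in> A" "card (nbrs_in A X v) \<le> D"
  shows "card (blocked A (X - S) c v) \<le> D" "finite (blocked A (X - S) c v)"
proof -
  have fin: "finite (nbrs_in A X v)" using assms(1) by (auto simp: nbrs_in_def)
  have sub: "nbrs_in A (X - S) v \<subseteq> nbrs_in A X v - {s}" using assms by (auto simp: nbrs_in_def)
  have s: "s \<in> nbrs_in A X v" using assms adj_sym[of s v] by (auto simp: nbrs_in_def)
  have fin': "finite (nbrs_in A (X - S) v)" using assms(1) by (auto simp: nbrs_in_def)
  show "finite (blocked A (X - S) c v)" using fin' by (auto simp: blocked_def)
  have "card (c ` nbrs_in A (X - S) v) \<le> card (nbrs_in A (X - S) v)" using fin' by (rule card_image_le)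
  also have "\<dots> \<le> card (nbrs_in A X v - {s})" using fin sub by (intro card_mono) auto
  also have "\<dots> = card (nbrs_in A X v) - 1" using s by simp
  finally have "card (c ` nbrs_in A (X - S) v) \<le> card (nbrs_in A X v) - 1" .
  moreover have "card (nbrs_in A X v) > 0" using s fin by (auto simp: card_gt_0_iff)
  moreover have "card (blocked A (X - S) c v) \<le> Suc (card (c ` nbrs_in A (X - S) v))"
    unfolding blocked_def by (rule card_insert_le_m1) auto
  ultimately show "card (blocked A (X - S) c v) \<le> D" using assms(6) by linarith
qed

definition reducible :: "'a set \<Rightarrow> nat \<Rightarrow> bool" where
  "reducible X k \<longleftrightarrow> (\<forall>Y. Y \<subset> X \<longrightarrow> (\<exists>c. strong_odd_on A Y k c)) \<longrightarrow> (\<exists>c. strong_odd_on A X k c)"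

lemma reducibleI:
  assumes "S \<subseteq> X" "S \<noteq> {}" "\<And>c. strong_odd_on A (X - S) k c \<Longrightarrow> \<exists>c. strong_odd_on A X k c"
  shows "reducible X k"
proof -
  have "X - S \<subset> X" using assms by auto
  then show ?thesis unfolding reducible_def using assms(3) by blast
qed

lemma two_nbrs:
  assumes "card (nbrs_in A X v) = 2" "u \<in> nbrs_in A X v"
  obtains x where "nbrs_in A X v = {u, x}" "x \<noteq> u"
  using assms by (auto simp: card_2_iff doubleton_eq_iff)

text \<open>The centre \<open>w\<close> and the set \<open>V2\<close> are deleted. On recolouring, \<open>w\<close> comes first: it is blocked by at
  most \<open>D\<close> colours because of \<open>y\<close> and must differ from the other neighbours \<open>x v\<close> of the
  \<open>v \<in> V2\<close>, which leaves a colour as \<open>D + card V2 < k\<close>. Afterwards each \<open>v \<in> V2\<close> has to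
  avoid at most \<open>D\<close> colours because of \<open>x v\<close> and the colour of \<open>w\<close>. The remaining lists are
  long enough for \<open>odd_choice\<close>, with the colour of \<open>y\<close> in the role of \<open>t\<close>.\<close>

lemma star_reducible:
  assumes X: "finite X" "w \<in> X" and D: "\<And>v. v \<in> X \<Longrightarrow> card (nbrs_in A X v) \<le> D"
    and V2: "V2 \<subseteq> nbrs_in A X w" "\<And>v. v \<in> V2 \<Longrightarrow> card (nbrs_in A X v) = 2"
    and y: "y \<in> nbrs_in A X w" "nbrs_in A X w = insert y V2" "y \<notin> V2"
    and k: "D + card (nbrs_in A X w) \<le> k" "D + 3 \<le> k"
  shows "reducible X k"
proof (rule reducibleI)
  let ?S = "insert w V2"
  show SX: "?S \<subseteq> X" "?S \<noteq> {}" using X V2 by (auto simp: nbrs_in_def)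
  fix c assume c: "strong_odd_on A (X - ?S) k c"
  let ?B = "blocked A (X - ?S) c"
  have finV: "finite V2" using X(1) V2(1) by (auto simp: nbrs_in_def intro: finite_subset)
  have cardw: "card (nbrs_in A X w) = Suc (card V2)" using y finV by simp
  have w: "(w, v) \<in> A" "(v, w) \<in> A" "v \<in> X" "v \<noteq> w" if "v \<in> V2" for v
    using that V2(1) adj_sym[of w v] adj_neq[of w v] by (auto simp: nbrs_in_def)
  have yw: "(w, y) \<in> A" "(y, w) \<in> A" "y \<in> X" "y \<noteq> w" using y(1) adj_sym[of w y] adj_neq[of w y] by (auto simp: nbrs_in_def)
  have "\<exists>x. nbrs_in A X v = {w, x} \<and> x \<noteq> w" if "v \<in> V2" for v
    using two_nbrs[OF V2(2)[OF that], of w] w[OF that] X(2) by (auto simp: nbrs_in_def)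
  then obtain x where x: "\<And>v. v \<in> V2 \<Longrightarrow> nbrs_in A X v = {w, x v} \<and> x v \<noteq> w" by metis
  have xv: "x v \<in> X" "(v, x v) \<in> A" "(x v, v) \<in> A" if "v \<in> V2" for v
  proof -
    have "x v \<in> nbrs_in A X v" using x[OF that] by simp
    then show "x v \<in> X" "(v, x v) \<in> A" "(x v, v) \<in> A" using adj_sym[of v "x v"] by (simp_all add: nbrs_in_def)
  qed
  have nonadj: "(v, v') \<notin> A" if "v \<in> V2" "v' \<in> V2" for v v'
    using no_cycle3[of w v v'] w that by blast
  have xS: "x v \<notin> ?S" if "v \<in> V2" for v
    using x[OF that] nonadj that xv[OF that] by auto
  have yS: "y \<notin> ?S" using y yw by auto
  have bx: "card (?B (x v)) \<le> D" "finite (?B (x v))" if "v \<in> V2" for v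
    using blocked_card[OF X(1) SX(1), of "x v" v D] xS xv that D by auto
  have block_y: "card (?B y) \<le> D" "finite (?B y)"
    using blocked_card[OF X(1) SX(1), of y w D] yS yw D by auto
  have "card (?B y \<union> (c \<circ> x) ` V2) \<le> D + card V2"
    using card_Un_le[of "?B y" "(c \<circ> x) ` V2"] block_y card_image_le[OF finV, of "c \<circ> x"] by linarith
  then obtain cw where cw: "cw \<in> {1..k}" "cw \<notin> ?B y" "\<And>v. v \<in> V2 \<Longrightarrow> cw \<noteq> c (x v)"
    using pick_color[of "?B y \<union> (c \<circ> x) ` V2" k] block_y finV k cardw by (auto simp: image_iff)
  define Lst where "Lst v = {1..k} - insert cw (?B (x v))" for v
  have big: "max 2 (card V2) \<le> card (Lst v)" if "v \<in> V2" for v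
    unfolding Lst_def using bx[OF that] k cardw by (intro card_free_colors) (auto simp: card_insert_if)
  obtain f where f: "\<And>v. v \<in> V2 \<Longrightarrow> f v \<in> Lst v" and f_odd: "repeats_oddly f V2 (c y)"
    using odd_choice[of V2 Lst "c y", OF finV big] by metis
  define g where "g = f(w := cw)"
  have gV: "g v = f v" if "v \<in> V2" for v using w that by (auto simp: g_def)
  let ?c = "override_on c g ?S"
  have cV: "?c v = f v" if "v \<in> V2" for v using gV that by simp
  have cy: "?c y = c y" using yS by simp
  have "strong_odd_on A X k ?c"
  proof (rule strong_odd_on_extend[OF SX(1) c])
    fix z s t assume z: "z \<in> X - ?S" and st: "s \<in> ?S" "t \<in> ?S" "(z, s) \<in> A" "(z, t) \<in> A"
    have tri: "False" if "v \<in> V2" "(z, w) \<in> A" "(z, v) \<in> A" for v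
      using no_cycle3[of z v w] that w adj_sym by blast
    have quad: "v = v'" if "v \<in> V2" "v' \<in> V2" "(z, v) \<in> A" "(z, v') \<in> A" for v v'
      using no_cycle4[of z v w v'] that w adj_sym z by blast
    show "s = t" using tri quad st by auto
  next
    fix s assume "s \<in> ?S"
    then show "g s \<in> {1..k}" using cw f gV by (auto simp: g_def Lst_def)
  next
    fix s v assume sv: "s \<in> ?S" "v \<in> X - ?S" "(s, v) \<in> A"
    show "g s \<notin> ?B v"
    proof (cases "s = w")
      case True
      then have "v \<in> nbrs_in A X w" using sv by (auto simp: nbrs_in_def)
      then show ?thesis using True sv y cw by (auto simp: g_def)
    next
      case False
      then have s: "s \<in> V2" using sv by auto
      have "v \<in> nbrs_in A X s" using sv by (auto simp: nbrs_in_def)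
      then have "v = x s" using x[OF s] sv by auto
      then show ?thesis using f[OF s] gV[OF s] by (auto simp: Lst_def)
    qed
  next
    fix s t assume st: "s \<in> ?S" "t \<in> ?S" "(s, t) \<in> A"
    then show "g s \<noteq> g t"
      using nonadj f gV adj_neq[OF st(3)] by (auto simp: g_def Lst_def)
  next
    fix s assume s: "s \<in> ?S"
    show "odd_classes ?c (nbrs_in A X s)"
    proof (cases "s = w")
      case True
      have "odd_classes ?c (insert y V2)"
        by (rule odd_classes_insert_repeated[OF y(3)]) (use f_odd cy cV in simp_all)
      then show ?thesis using True y(2) by simp
    next
      case False
      then have "s \<in> V2" using s by simp
      then have "?c w \<noteq> ?c (x s)" using cw(3)[of s] xS[of s] by (simp add: g_def)
      then show ?thesis using x[OF \<open>s \<in> V2\<close>] by (intro odd_classes_inj) (auto simp: inj_on_def)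
    qed
  qed
  then show "\<exists>c. strong_odd_on A X k c" by (rule exI[of _ ?c])
qed

text \<open>A vertex of degree three with a neighbour of degree two, which is the only one
  unless the vertex is the centre of a reducible star.\<close>

definition light3 :: "'a set \<Rightarrow> 'a \<Rightarrow> 'a \<Rightarrow> bool" where
  "light3 X u v \<longleftrightarrow> u \<in> X \<and> v \<in> nbrs_in A X u \<and> card (nbrs_in A X u) = 3 \<and> card (nbrs_in A X v) = 2"

lemma light3_nbrs:
  assumes "light3 X u v" "p \<in> nbrs_in A X u" "p \<noteq> v"
  obtains y x where "nbrs_in A X u = {v, p, y}" "y \<noteq> v" "y \<noteq> p" "nbrs_in A X v = {u, x}" "x \<noteq> u"
proof -
  have "card (nbrs_in A X u - {v, p}) = 1" "v \<in> nbrs_in A X u"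
    using assms by (auto simp: light3_def card_Diff_subset)
  then obtain y where "nbrs_in A X u - {v, p} = {y}" by (auto simp: card_1_singleton_iff)
  then have y: "nbrs_in A X u = {v, p, y}" "y \<noteq> v" "y \<noteq> p" using assms(2) \<open>v \<in> nbrs_in A X u\<close> by auto
  have "u \<in> nbrs_in A X v" using assms(1) adj_sym[of u v] by (auto simp: light3_def nbrs_in_def)
  then obtain x where "nbrs_in A X v = {u, x}" "x \<noteq> u"
    using two_nbrs[of X v u] assms(1) by (auto simp: light3_def)
  then show thesis using that y by blast
qed

text \<open>The path \<open>v1, u1, u2, v2\<close> is deleted. Each of its vertices has one neighbour outside, \<open>x1\<close>, \<open>y1\<close>, \<open>y2\<close>
  and \<open>x2\<close>, which blocks at most \<open>D\<close> colours. Colouring \<open>u1\<close>, \<open>u2\<close>, \<open>v1\<close>, \<open>v2\<close> in this order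
  such that all vertices at distance at most two differ, at most three further colours have to be
  avoided each time.\<close>

lemma adjacent_light3_reducible:
  assumes X: "finite X" and D: "\<And>v. v \<in> X \<Longrightarrow> card (nbrs_in A X v) \<le> D" and k: "D + 4 \<le> k"
    and l1: "light3 X u1 v1" and l2: "light3 X u2 v2" and u12: "(u1, u2) \<in> A" "v1 \<noteq> u2" "v2 \<noteq> u1"
  shows "reducible X k"
proof (rule reducibleI)
  let ?S = "{u1, u2, v1, v2}"
  show SX: "?S \<subseteq> X" "?S \<noteq> {}" using l1 l2 by (auto simp: light3_def nbrs_in_def)
  fix c assume c: "strong_odd_on A (X - ?S) k c"
  let ?B = "blocked A (X - ?S) c"
  have u21: "(u2, u1) \<in> A" by (rule adj_sym[OF u12(1)])
  obtain y1 x1 where n1: "nbrs_in A X u1 = {v1, u2, y1}" "y1 \<noteq> v1" "y1 \<noteq> u2" "nbrs_in A X v1 = {u1, x1}" "x1 \<noteq> u1"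
    using light3_nbrs[OF l1, of u2] u12 SX by (auto simp: nbrs_in_def)
  obtain y2 x2 where n2: "nbrs_in A X u2 = {v2, u1, y2}" "y2 \<noteq> v2" "y2 \<noteq> u1" "nbrs_in A X v2 = {u2, x2}" "x2 \<noteq> u2"
    using light3_nbrs[OF l2, of u1] u12 u21 SX by (auto simp: nbrs_in_def)
  have mem: "v1 \<in> nbrs_in A X u1" "y1 \<in> nbrs_in A X u1" "x1 \<in> nbrs_in A X v1"
    "v2 \<in> nbrs_in A X u2" "y2 \<in> nbrs_in A X u2" "x2 \<in> nbrs_in A X v2" using n1 n2 by simp_all
  have adj: "(u1, v1) \<in> A" "(u1, y1) \<in> A" "(v1, x1) \<in> A" "(u2, v2) \<in> A" "(u2, y2) \<in> A" "(v2, x2) \<in> A"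
    and inX: "y1 \<in> X" "x1 \<in> X" "y2 \<in> X" "x2 \<in> X"
    using mem by (simp_all add: nbrs_in_def)
  note adj' = adj[THEN adj_sym]
  note neq = adj[THEN adj_neq] u12(1)[THEN adj_neq]
  have v12: "v1 \<noteq> v2" using no_cycle3[of u1 v1 u2] adj adj' u21 by blast
  have vv: "(v1, v2) \<notin> A" using no_cycle4[of u1 v1 v2 u2] adj adj' u12 u21 by blast
  have x1S: "x1 \<notin> ?S"
    using n1(5) neq vv adj(3) no_cycle3[of u1 v1 u2] adj u21 by blast
  have x2S: "x2 \<notin> ?S"
    using n2(5) neq vv adj(6) no_cycle3[of u2 v2 u1] adj u12 adj_sym by blast
  have y1S: "y1 \<notin> ?S"
    using n1(2,3) neq no_cycle3[of u1 v2 u2] adj adj' u21 by blast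
  have y2S: "y2 \<notin> ?S"
    using n2(2,3) neq no_cycle3[of u2 v1 u1] adj adj' u12 by blast
  have B: "card (?B y1) \<le> D" "finite (?B y1)" "card (?B y2) \<le> D" "finite (?B y2)"
     "card (?B x1) \<le> D" "finite (?B x1)" "card (?B x2) \<le> D" "finite (?B x2)"
    using blocked_card[OF X SX(1), of y1 u1 D c] blocked_card[OF X SX(1), of y2 u2 D c]
      blocked_card[OF X SX(1), of x1 v1 D c] blocked_card[OF X SX(1), of x2 v2 D c]
      x1S x2S y1S y2S inX adj D by simp_all
  have pick: "\<exists>i \<in> {1..k}. i \<notin> F \<and> i \<noteq> p \<and> i \<noteq> q \<and> i \<noteq> r" if "finite F" "card F \<le> D"
    for F :: "nat set" and p q r
  proof -
    have "card (insert p (insert q (insert r F))) \<le> Suc (Suc (Suc (card F)))"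
      using that(1) by (auto simp: card_insert_if)
    then show ?thesis using pick_color[of "insert p (insert q (insert r F))" k] that k by auto
  qed
  obtain a1 where a1: "a1 \<in> {1..k}" "a1 \<notin> ?B y1" "a1 \<noteq> c x1" "a1 \<noteq> c y2"
    using pick[OF B(2,1), of "c x1" "c y2" "c y2"] by blast
  obtain a2 where a2: "a2 \<in> {1..k}" "a2 \<notin> ?B y2" "a2 \<noteq> c x2" "a2 \<noteq> c y1" "a2 \<noteq> a1"
    using pick[OF B(4,3), of "c x2" "c y1" a1] by blast
  obtain b1 where b1: "b1 \<in> {1..k}" "b1 \<notin> ?B x1" "b1 \<noteq> c y1" "b1 \<noteq> a1" "b1 \<noteq> a2"
    using pick[OF B(6,5), of "c y1" a1 a2] by blast
  obtain b2 where b2: "b2 \<in> {1..k}" "b2 \<notin> ?B x2" "b2 \<noteq> c y2" "b2 \<noteq> a1" "b2 \<noteq> a2"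
    using pick[OF B(8,7), of "c y2" a1 a2] by blast
  define g where "g = c(u1 := a1, u2 := a2, v1 := b1, v2 := b2)"
  have g: "g u1 = a1" "g u2 = a2" "g v1 = b1" "g v2 = b2"
    using neq v12 u12 by (auto simp: g_def)
  let ?c = "override_on c g ?S"
  have cc: "?c u1 = a1" "?c u2 = a2" "?c v1 = b1" "?c v2 = b2"
     "?c x1 = c x1" "?c x2 = c x2" "?c y1 = c y1" "?c y2 = c y2"
    using g x1S x2S y1S y2S by simp_all
  have "strong_odd_on A X k ?c"
  proof (rule strong_odd_on_extend[OF SX(1) c])
    fix z s t assume z: "z \<in> X - ?S" and st: "s \<in> ?S" "t \<in> ?S" "(z, s) \<in> A" "(z, t) \<in> A"
    have zz: "z \<noteq> u1" "z \<noteq> u2" "z \<noteq> v1" "z \<noteq> v2" using z by auto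
    have 1: "\<not> ((z, u1) \<in> A \<and> (z, u2) \<in> A)" using no_cycle3[of z u1 u2] u12 adj_sym by blast
    have 2: "\<not> ((z, u1) \<in> A \<and> (z, v1) \<in> A)" using no_cycle3[of z u1 v1] adj adj_sym by blast
    have 3: "\<not> ((z, u2) \<in> A \<and> (z, v2) \<in> A)" using no_cycle3[of z u2 v2] adj adj_sym by blast
    have 4: "\<not> ((z, u1) \<in> A \<and> (z, v2) \<in> A)"
      using no_cycle4[of z u1 u2 v2] adj u12 adj_sym zz by blast
    have 5: "\<not> ((z, u2) \<in> A \<and> (z, v1) \<in> A)"
      using no_cycle4[of z u2 u1 v1] adj u12 u21 adj_sym zz by blast
    have 6: "\<not> ((z, v1) \<in> A \<and> (z, v2) \<in> A)"
      using no_cycle5[of z v1 u1 u2 v2] adj adj' u12 adj_sym by blast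
    show "s = t" using st 1 2 3 4 5 6 by auto
  next
    fix s assume "s \<in> ?S"
    then show "g s \<in> {1..k}" using g a1 a2 b1 b2 by auto
  next
    fix s v assume s: "s \<in> ?S" and v: "v \<in> X - ?S" "(s, v) \<in> A"
    have "v \<in> nbrs_in A X s" using v by (simp add: nbrs_in_def)
    then have "s = u1 \<and> v = y1 \<or> s = u2 \<and> v = y2 \<or> s = v1 \<and> v = x1 \<or> s = v2 \<and> v = x2"
      using s v(1) n1 n2 by auto
    then show "g s \<notin> ?B v" using g a1 a2 b1 b2 by auto
  next
    fix s t assume st: "s \<in> ?S" "t \<in> ?S" "(s, t) \<in> A"
    have "s = t \<or> g s \<noteq> g t \<or> (s, t) = (v1, v2) \<or> (t, s) = (v1, v2)"
      using st(1,2) unfolding insert_iff empty_iff simp_thms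
      by (elim disjE) (simp_all add: g a2(5) b1(4,5) b2(4,5) a2(5)[symmetric] b1(4,5)[symmetric] b2(4,5)[symmetric])
    then show "g s \<noteq> g t"
      using st(3) adj_neq[OF st(3)] vv adj_sym[OF st(3)] by auto
  next
    fix s assume "s \<in> ?S"
    moreover have "odd_classes ?c (nbrs_in A X u1)" unfolding n1(1)
      by (rule odd_classes_three; unfold cc) (use a2(4) b1(3,5) in simp_all)
    moreover have "odd_classes ?c (nbrs_in A X u2)" unfolding n2(1)
      by (rule odd_classes_three; unfold cc) (use a1(4) b2(3,4) in simp_all)
    moreover have "odd_classes ?c (nbrs_in A X v1)" unfolding n1(4)
      by (rule odd_classes_two; unfold cc) (rule a1(3))
    moreover have "odd_classes ?c (nbrs_in A X v2)" unfolding n2(4)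
      by (rule odd_classes_two; unfold cc) (rule a2(3))
    ultimately show "odd_classes ?c (nbrs_in A X s)" by blast
  qed
  then show "\<exists>c. strong_odd_on A X k c" by (rule exI[of _ ?c])
qed

text \<open>All neighbours \<open>u\<close> of \<open>w\<close>, their neighbours \<open>v u\<close> of degree two, and \<open>w\<close> are deleted. Let \<open>y u\<close> and
  \<open>x u\<close> be the remaining neighbours of \<open>u\<close> and \<open>v u\<close>. The three vertices \<open>u\<close> have at least three colours
  each, so they can be coloured differently. Then \<open>w\<close> has to differ from these three and from the
  three \<open>y u\<close>, but at least seven colours exist as \<open>D \<ge> 3\<close>. Finally each \<open>v u\<close> avoids at most
  \<open>D\<close> colours because of \<open>x u\<close> and those of \<open>u\<close>, \<open>w\<close> and \<open>y u\<close>.\<close>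

lemma light3_star_reducible:
  assumes X: "finite X" and D: "\<And>v. v \<in> X \<Longrightarrow> card (nbrs_in A X v) \<le> D" and k: "D + 4 \<le> k"
    and w: "w \<in> X" "card (nbrs_in A X w) = 3"
    and l: "\<And>u. u \<in> nbrs_in A X w \<Longrightarrow> light3 X u (v u) \<and> v u \<noteq> w"
  shows "reducible X k"
proof (rule reducibleI)
  define U where "U = nbrs_in A X w"
  let ?S = "insert w (U \<union> v ` U)"
  have U3: "card U = 3" "finite U" using w by (simp_all add: U_def card_ge_0_finite)
  have lU: "light3 X u (v u)" "v u \<noteq> w" if "u \<in> U" for u using l that by (auto simp: U_def)
  have wu: "(w, u) \<in> A" "(u, w) \<in> A" "u \<in> X" "u \<noteq> w" if "u \<in> U" for u
    using that adj_sym[of w u] adj_neq[of w u] by (auto simp: U_def nbrs_in_def)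
  have vX: "(u, v u) \<in> A" "(v u, u) \<in> A" "v u \<in> X" if "u \<in> U" for u
    using lU(1)[OF that] adj_sym[of u "v u"] by (auto simp: light3_def nbrs_in_def)
  show SX: "?S \<subseteq> X" "?S \<noteq> {}" using w wu vX by auto
  fix c assume c: "strong_odd_on A (X - ?S) k c"
  let ?B = "blocked A (X - ?S) c"
  have "\<exists>y x. nbrs_in A X u = {v u, w, y} \<and> y \<noteq> v u \<and> y \<noteq> w \<and> nbrs_in A X (v u) = {u, x} \<and> x \<noteq> u" if "u \<in> U" for u
  proof -
    have "w \<in> nbrs_in A X u" using wu[OF that] w(1) by (simp add: nbrs_in_def)
    from light3_nbrs[OF lU(1)[OF that] this lU(2)[OF that, symmetric]] show ?thesis by metis
  qed
  then obtain y x where n: "\<And>u. u \<in> U \<Longrightarrow> nbrs_in A X u = {v u, w, y u}"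
    and yne: "\<And>u. u \<in> U \<Longrightarrow> y u \<noteq> v u \<and> y u \<noteq> w"
    and nv: "\<And>u. u \<in> U \<Longrightarrow> nbrs_in A X (v u) = {u, x u}" and xne: "\<And>u. u \<in> U \<Longrightarrow> x u \<noteq> u" by metis
  have ya: "(u, y u) \<in> A" "(y u, u) \<in> A" "y u \<in> X" if "u \<in> U" for u
  proof -
    have "y u \<in> nbrs_in A X u" using n[OF that] by simp
    then show "(u, y u) \<in> A" "(y u, u) \<in> A" "y u \<in> X" using adj_sym[of u "y u"] by (simp_all add: nbrs_in_def)
  qed
  have xa: "(v u, x u) \<in> A" "(x u, v u) \<in> A" "x u \<in> X" if "u \<in> U" for u
  proof -
    have "x u \<in> nbrs_in A X (v u)" using nv[OF that] by simp
    then show "(v u, x u) \<in> A" "(x u, v u) \<in> A" "x u \<in> X" using adj_sym[of "v u" "x u"] by (simp_all add: nbrs_in_def)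
  qed
  have UU: "(u, u') \<notin> A" if "u \<in> U" "u' \<in> U" for u u'
    using no_cycle3[of w u u'] wu that by blast
  have inj_v: "u = u'" if "u \<in> U" "u' \<in> U" "v u = v u'" for u u'
    using no_cycle4[of w u "v u" u'] wu[OF that(1)] wu[OF that(2)] vX[OF that(1)] vX[OF that(2)]
      that(3) lU(2)[OF that(1)] by metis
  have Uv: "v u \<notin> U" if "u \<in> U" for u
    using UU that vX by blast
  have Uv_adj: "u = u'" if "u \<in> U" "u' \<in> U" "(u, v u') \<in> A" for u u'
    using no_cycle4[of w u "v u'" u'] wu[OF that(1)] wu[OF that(2)] vX[OF that(2)]
      that(3) lU(2)[OF that(2)] by metis
  have vv: "(v u, v u') \<notin> A" if "u \<in> U" "u' \<in> U" for u u'
    using no_cycle5[of w u "v u" "v u'" u'] wu[OF that(1)] wu[OF that(2)] vX[OF that(1)] vX[OF that(2)] by metis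
  have wv: "(w, v u) \<notin> A" if "u \<in> U" for u
    using no_cycle3[of w "v u" u] wu[OF that] vX[OF that] by metis
  have xS: "x u \<notin> ?S" if "u \<in> U" for u
  proof
    assume "x u \<in> ?S"
    then consider "x u = w" | "x u \<in> U" | u' where "u' \<in> U" "x u = v u'" by auto
    then show False
    proof cases
      case 1 then show ?thesis using wv[OF that] xa[OF that] by simp
    next
      case 2 then show ?thesis using Uv_adj[OF 2 that] xa[OF that] xne[OF that] by simp
    next
      case 3 then show ?thesis using vv[OF that 3(1)] xa[OF that] by simp
    qed
  qed
  have yS: "y u \<notin> ?S" if "u \<in> U" for u
  proof
    assume "y u \<in> ?S"
    then consider "y u = w" | "y u \<in> U" | u' where "u' \<in> U" "y u = v u'" by auto
    then show False
    proof cases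
      case 1 then show ?thesis using yne[OF that] by simp
    next
      case 2 then show ?thesis using UU[OF that 2] ya[OF that] by simp
    next
      case 3 then show ?thesis using Uv_adj[OF that 3(1)] ya[OF that] yne[OF that] by auto
    qed
  qed
  have block_y: "card (?B (y u)) \<le> D" "finite (?B (y u))" if "u \<in> U" for u
    using blocked_card[OF X SX(1), of "y u" u D c] yS[OF that] ya[OF that] D that by auto
  have block_x: "card (?B (x u)) \<le> D" "finite (?B (x u))" if "u \<in> U" for u
    using blocked_card[OF X SX(1), of "x u" "v u" D c] xS[OF that] xa[OF that] D that by auto
  have "card U \<le> card ({1..k} - insert (c (x u)) (?B (y u)))" if "u \<in> U" for u
    using block_y[OF that] k U3 by (intro card_free_colors) (auto simp: card_insert_if)
  then obtain f where f: "inj_on f U" "\<And>u. u \<in> U \<Longrightarrow> f u \<in> {1..k} - insert (c (x u)) (?B (y u))"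
    using distinct_choice[OF U3(2), of "\<lambda>u. {1..k} - insert (c (x u)) (?B (y u))"] by blast
  have "D \<ge> 3" using D[OF w(1)] w(2) by simp
  moreover have "card (f ` U \<union> (c \<circ> y) ` U) \<le> 6"
    using card_Un_le[of "f ` U" "(c \<circ> y) ` U"] card_image_le[OF U3(2), of f]
      card_image_le[OF U3(2), of "c \<circ> y"] U3(1) by linarith
  ultimately obtain cw where "cw \<in> {1..k}" "cw \<notin> f ` U \<union> (c \<circ> y) ` U"
    using pick_color[of "f ` U \<union> (c \<circ> y) ` U" k] U3(2) k by auto
  then have cw: "cw \<in> {1..k}" "\<And>u. u \<in> U \<Longrightarrow> cw \<noteq> f u" "\<And>u. u \<in> U \<Longrightarrow> cw \<noteq> c (y u)" by auto
  have "\<exists>b \<in> {1..k}. b \<notin> insert (c (y u)) (insert (f u) (insert cw (?B (x u))))" if "u \<in> U" for u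
  proof (rule pick_color)
    have "card (insert (c (y u)) (insert (f u) (insert cw (?B (x u))))) \<le> Suc (Suc (Suc (card (?B (x u)))))"
      using block_x[OF that] by (auto simp: card_insert_if)
    then show "card (insert (c (y u)) (insert (f u) (insert cw (?B (x u))))) < k"
      using block_x[OF that] k by linarith
  qed (use block_x[OF that] in auto)
  then obtain b where b: "\<And>u. u \<in> U \<Longrightarrow> b u \<in> {1..k} \<and> b u \<notin> ?B (x u) \<and> b u \<noteq> c (y u) \<and> b u \<noteq> f u \<and> b u \<noteq> cw"
    by (metis insert_iff)
  define g where "g s = (if s = w then cw else if s \<in> U then f s else b (inv_into U v s))" for s
  have inj: "inj_on v U" using inj_v by (auto simp: inj_on_def)
  have g: "g w = cw" "\<And>u. u \<in> U \<Longrightarrow> g u = f u" "\<And>u. u \<in> U \<Longrightarrow> g (v u) = b u"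
    using wu(4) lU(2) Uv inv_into_f_f[OF inj] by (auto simp: g_def)
  let ?c = "override_on c g ?S"
  have cc: "?c w = cw" "\<And>u. u \<in> U \<Longrightarrow> ?c u = f u" "\<And>u. u \<in> U \<Longrightarrow> ?c (v u) = b u"
    "\<And>u. u \<in> U \<Longrightarrow> ?c (x u) = c (x u)" "\<And>u. u \<in> U \<Longrightarrow> ?c (y u) = c (y u)"
    using g xS yS by simp_all
  have S_cases: "s = w \<or> s \<in> U \<or> (\<exists>u \<in> U. s = v u)" if "s \<in> ?S" for s using that by blast
  have "strong_odd_on A X k ?c"
  proof (rule strong_odd_on_extend[OF SX(1) c])
    fix z s t assume z: "z \<in> X - ?S" and st: "s \<in> ?S" "t \<in> ?S" "(z, s) \<in> A" "(z, t) \<in> A"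
    have zz: "z \<noteq> w" "z \<notin> U" "\<And>u. u \<in> U \<Longrightarrow> z \<noteq> v u" using z by auto
    have zw: "(z, w) \<notin> A" using zz z adj_sym[of z w] by (auto simp: U_def nbrs_in_def)
    have 1: "u = u'" if "u \<in> U" "u' \<in> U" "(z, u) \<in> A" "(z, u') \<in> A" for u u'
      using no_cycle4[of z u w u'] wu[OF that(1)] wu[OF that(2)] that(3) adj_sym[OF that(4)] zz(1) by blast
    have 2: False if "u \<in> U" "u' \<in> U" "(z, u) \<in> A" "(z, v u') \<in> A" for u u'
      using no_cycle5[of z u w u' "v u'"] wu[OF that(1)] wu[OF that(2)] vX[OF that(2)] that(3) adj_sym[OF that(4)] by blast
    have 3: "u = u'" if "u \<in> U" "u' \<in> U" "(z, v u) \<in> A" "(z, v u') \<in> A" for u u'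
    proof (rule ccontr)
      assume ne: "u \<noteq> u'"
      then have "v u \<noteq> v u'" using inj_v that by blast
      then show False
        using no_cycle6[of z "v u" u w u' "v u'"] vX[OF that(1)] vX[OF that(2)] wu[OF that(1)] wu[OF that(2)]
          that(1-3) adj_sym[OF that(4)] ne zz(2) lU(2)[OF that(1)] lU(2)[OF that(2)] by metis
    qed
    show "s = t"
      using S_cases[OF st(1)] S_cases[OF st(2)] st(3,4) zw 1 2 3 by metis
  next
    fix s assume "s \<in> ?S"
    from S_cases[OF this] show "g s \<in> {1..k}" using g cw f(2) b by (metis DiffD1)
  next
    fix s z assume s: "s \<in> ?S" and z: "z \<in> X - ?S" "(s, z) \<in> A"
    have zn: "z \<in> nbrs_in A X s" using z by (simp add: nbrs_in_def)
    from S_cases[OF s] show "g s \<notin> ?B z"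
    proof (elim disjE bexE)
      assume "s = w" then show ?thesis using zn z by (simp add: U_def)
    next
      assume sU: "s \<in> U"
      then have "z = y s" using zn n[OF sU] z(1) by auto
      then show ?thesis using g(2)[OF sU] f(2)[OF sU] by simp
    next
      fix u assume u: "u \<in> U" "s = v u"
      then have "z = x u" using zn nv[OF u(1)] z(1) by auto
      then show ?thesis using g(3)[OF u(1)] b[OF u(1)] u(2) by simp
    qed
  next
    fix s t assume st: "s \<in> ?S" "t \<in> ?S" "(s, t) \<in> A"
    note ts = adj_sym[OF st(3)]
    show "g s \<noteq> g t"
      using S_cases[OF st(1)] S_cases[OF st(2)]
    proof (elim disjE bexE)
      assume "s = w" "t = w" then show ?thesis using adj_neq[OF st(3)] by simp
    next
      assume "s = w" "t \<in> U" then show ?thesis using g cw(2) by simp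
    next
      fix u assume "s = w" "u \<in> U" "t = v u" then show ?thesis using wv st(3) by simp
    next
      assume "s \<in> U" "t = w" then show ?thesis using g cw(2)[of s] by simp
    next
      assume "s \<in> U" "t \<in> U" then show ?thesis using UU st(3) by blast
    next
      fix u assume u: "s \<in> U" "u \<in> U" "t = v u"
      then have "s = u" using Uv_adj[of s u] st(3) by blast
      then show ?thesis using g(2,3)[OF u(2)] b[OF u(2)] u(3) by auto
    next
      fix u assume "t = w" "u \<in> U" "s = v u" then show ?thesis using wv ts by simp
    next
      fix u assume u: "t \<in> U" "u \<in> U" "s = v u"
      then have "t = u" using Uv_adj[of t u] ts by blast
      then show ?thesis using g(2,3)[OF u(2)] b[OF u(2)] u(3) by auto
    next
      fix u u' assume "u \<in> U" "s = v u" "u' \<in> U" "t = v u'" then show ?thesis using vv st(3) by blast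
    qed
  next
    fix s assume s: "s \<in> ?S"
    from S_cases[OF s] show "odd_classes ?c (nbrs_in A X s)"
    proof (elim disjE bexE)
      assume "s = w"
      moreover have "inj_on ?c U" using f(1) cc(2) by (simp add: inj_on_def)
      ultimately show ?thesis using odd_classes_inj by (simp add: U_def)
    next
      assume u: "s \<in> U"
      have "odd_classes ?c {v s, w, y s}"
        by (rule odd_classes_three; unfold cc(1) cc(3)[OF u] cc(5)[OF u]) (use b[OF u] cw(3)[OF u] in simp_all)
      then show ?thesis using n[OF u] by simp
    next
      fix u assume u: "u \<in> U" "s = v u"
      have "odd_classes ?c {u, x u}"
        by (rule odd_classes_two; unfold cc(2)[OF u(1)] cc(4)[OF u(1)]) (use f(2)[OF u(1)] in simp)
      then show ?thesis using nv[OF u(1)] u(2) by simp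
    qed
  qed
  then show "\<exists>c. strong_odd_on A X k c" by (rule exI[of _ ?c])
qed

end

section \<open>Discharging\<close>

text \<open>Every vertex starts with \<open>m\<close> times its degree and \<open>v\<close> sends \<open>give v u\<close> to its neighbour \<open>u\<close>. If every
  vertex ends with at least \<open>K\<close>, so does the average.\<close>

lemma discharging:
  assumes "sym A" "finite X"
    and "\<And>v. v \<in> X \<Longrightarrow> K + (\<Sum>u \<in> nbrs_in A X v. give v u) \<le> m * card (nbrs_in A X v) + (\<Sum>u \<in> nbrs_in A X v. give u v)"
  shows "K * card X \<le> m * (\<Sum>v \<in> X. card (nbrs_in A X v))"
proof -
  have swap: "(\<Sum>v \<in> X. \<Sum>u \<in> nbrs_in A X v. give u v) = (\<Sum>v \<in> X. \<Sum>u \<in> nbrs_in A X v. (give v u :: nat))"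
  proof -
    have "(\<Sum>v \<in> X. \<Sum>u \<in> nbrs_in A X v. give u v) = (\<Sum>u \<in> X. \<Sum>v | v \<in> X \<and> (v, u) \<in> A. give u v)"
      unfolding nbrs_in_def by (rule sum.swap_restrict[OF assms(2,2)])
    also have "\<dots> = (\<Sum>u \<in> X. \<Sum>v \<in> nbrs_in A X u. give u v)"
      using assms(1) by (intro sum.cong) (auto simp: nbrs_in_def dest: symD)
    finally show ?thesis .
  qed
  have "(\<Sum>v \<in> X. K + (\<Sum>u \<in> nbrs_in A X v. give v u)) \<le>
      (\<Sum>v \<in> X. m * card (nbrs_in A X v) + (\<Sum>u \<in> nbrs_in A X v. give u v))"
    using assms(3) by (rule sum_mono)
  then show ?thesis
    using swap by (simp add: sum.distrib sum_distrib_left mult.commute)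
qed

context girth7
begin

abbreviation deg :: "'a set \<Rightarrow> 'a \<Rightarrow> nat" where
  "deg X v \<equiv> card (nbrs_in A X v)"

definition heavy_nbrs :: "'a set \<Rightarrow> 'a \<Rightarrow> 'a set" where
  "heavy_nbrs X v = {u \<in> nbrs_in A X v. deg X u \<noteq> 2}"

lemma deg_split:
  assumes "finite X"
  shows "deg X v = card {u \<in> nbrs_in A X v. deg X u = 2} + card (heavy_nbrs X v)"
proof -
  have "nbrs_in A X v = {u \<in> nbrs_in A X v. deg X u = 2} \<union> heavy_nbrs X v"
    "{u \<in> nbrs_in A X v. deg X u = 2} \<inter> heavy_nbrs X v = {}" by (auto simp: heavy_nbrs_def)
  moreover have "finite (nbrs_in A X v)" using assms by (simp add: nbrs_in_def)
  ultimately show ?thesis by (metis (no_types, lifting) card_Un_disjoint finite_Un)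
qed

text \<open>An isolated vertex may get any colour; otherwise one neighbour is exempted and the star at \<open>w\<close> is used.\<close>

lemma few_heavy_reducible:
  assumes X: "finite X" "w \<in> X" and D: "\<And>v. v \<in> X \<Longrightarrow> deg X v \<le> D"
    and w: "card (heavy_nbrs X w) \<le> 1" and k: "D + deg X w \<le> k" "D + 3 \<le> k"
  shows "reducible X k"
proof -
  have fin: "finite (nbrs_in A X w)" using X by (simp add: nbrs_in_def)
  show ?thesis
  proof (cases "nbrs_in A X w = {}")
    case True
    show ?thesis
    proof (rule reducibleI[of "{w}"])
      fix c assume c: "strong_odd_on A (X - {w}) k c"
      have "strong_odd_on A X k (override_on c (\<lambda>_. 1) {w})"
      proof (rule strong_odd_on_extend[OF _ c])
        fix s v assume "s \<in> {w}" "v \<in> X - {w}" "(s, v) \<in> A"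
        then show "1 \<notin> blocked A (X - {w}) c v" using True by (auto simp: nbrs_in_def)
      next
        fix s t assume "s \<in> {w}" "t \<in> {w}" "(s, t) \<in> A"
        then show "(1::nat) \<noteq> 1" using adj_neq[of s t] by auto
      next
        fix s assume "s \<in> {w}"
        then show "odd_classes (override_on c (\<lambda>_. 1) {w}) (nbrs_in A X s)" using True by (simp add: odd_classes_def)
      qed (use X(2) k in auto)
      then show "\<exists>c. strong_odd_on A X k c" by (rule exI[of _ "override_on c (\<lambda>_. 1) {w}"])
    qed (use X in auto)
  next
    case False
    have "\<exists>y \<in> nbrs_in A X w. heavy_nbrs X w \<subseteq> {y}"
    proof (cases "heavy_nbrs X w = {}")
      case True
      then show ?thesis using False by auto
    next
      case ne: False
      have "finite (heavy_nbrs X w)" using fin by (simp add: heavy_nbrs_def)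
      then have "card (heavy_nbrs X w) = 1" using w ne card_0_eq[of "heavy_nbrs X w"] by linarith
      then obtain y where "heavy_nbrs X w = {y}" by (auto simp: card_1_singleton_iff)
      then show ?thesis unfolding heavy_nbrs_def by blast
    qed
    then obtain y where y: "y \<in> nbrs_in A X w" "heavy_nbrs X w \<subseteq> {y}" by blast
    show ?thesis
    proof (rule star_reducible[OF X D _ _ y(1) _ _ k])
      show "deg X v = 2" if "v \<in> nbrs_in A X w - {y}" for v
        using that y(2) by (auto simp: heavy_nbrs_def)
    qed (use y in auto)
  qed
qed

text \<open>With initial charge three times the degree, every vertex of degree two takes 1 from each of its two
  neighbours. These have degree at least three: a vertex of degree three then loses at most 1 and one of
  degree \<open>d \<ge> 4\<close> at most \<open>d\<close>, which leaves at least 8.\<close>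

lemma dense_if_many_heavy_nbrs_8_3:
  assumes X: "finite X" and heavy: "\<And>v. v \<in> X \<Longrightarrow> deg X v \<le> 3 \<Longrightarrow> 2 \<le> card (heavy_nbrs X v)"
  shows "8 * card X \<le> 3 * (\<Sum>v \<in> X. deg X v)"
proof (rule discharging[OF sym_A X, where give = "\<lambda>v u. if deg X u = 2 \<and> deg X v \<noteq> 2 then 1 else 0"])
  fix v assume v: "v \<in> X"
  have fin: "finite (nbrs_in A X v)" using X by (simp add: nbrs_in_def)
  let ?L = "{u \<in> nbrs_in A X v. deg X u = 2}"
  note split = deg_split[OF X, of v]
  have out: "(\<Sum>u \<in> nbrs_in A X v. if deg X u = 2 \<and> deg X v \<noteq> 2 then 1 else 0) = (if deg X v = 2 then 0 else card ?L)"
    using fin by (simp add: sum.If_cases Int_def)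
  have inn: "(\<Sum>u \<in> nbrs_in A X v. if deg X v = 2 \<and> deg X u \<noteq> 2 then 1 else 0) = (if deg X v = 2 then card (heavy_nbrs X v) else 0)"
    using fin by (simp add: sum.If_cases Int_def heavy_nbrs_def)
  show "8 + (\<Sum>u \<in> nbrs_in A X v. if deg X u = 2 \<and> deg X v \<noteq> 2 then 1 else 0)
      \<le> 3 * deg X v + (\<Sum>u \<in> nbrs_in A X v. if deg X v = 2 \<and> deg X u \<noteq> 2 then 1 else 0)"
    unfolding out inn using split heavy[OF v] by (cases "deg X v \<le> 3") auto
qed

text \<open>With initial charge ten times the degree, every vertex of degree two takes 4 from each of its neighbours
  and thereby reaches 28. A vertex of degree three that has to pay 4 is short of 2, and takes 1 from each of
  its two other neighbours, none of which is in the same situation. A different vertex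
  of degree three pays 1 at most twice, a vertex of degree four pays 4 at most twice
  and 1 otherwise, and for degree \<open>d \<ge> 5\<close> even paying 4 to all neighbours leaves \<open>6 d \<ge> 28\<close>.\<close>

lemma dense_if_unavoidable_14_5:
  assumes X: "finite X" and heavy: "\<And>v. v \<in> X \<Longrightarrow> deg X v \<le> 4 \<Longrightarrow> 2 \<le> card (heavy_nbrs X v)"
    and isolated: "\<And>u v p q. u \<in> X \<Longrightarrow> v \<in> nbrs_in A X u \<Longrightarrow> \<not> (light3 X u p \<and> light3 X v q)"
    and not_all: "\<And>w. w \<in> X \<Longrightarrow> deg X w = 3 \<Longrightarrow> \<exists>u \<in> nbrs_in A X w. \<nexists>p. light3 X u p"
  shows "28 * card X \<le> 10 * (\<Sum>v \<in> X. deg X v)"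
proof -
  define light where "light u \<longleftrightarrow> (\<exists>p. light3 X u p)" for u
  define give where "give v u = (if deg X v = 2 then 0 else if deg X u = 2 then 4 else if light u then 1 else 0 :: nat)" for v u
  show ?thesis
  proof (rule discharging[OF sym_A X, where give = give])
    fix v assume v: "v \<in> X"
    have fin: "finite (nbrs_in A X v)" using X by (simp add: nbrs_in_def)
    let ?L = "{u \<in> nbrs_in A X v. deg X u = 2}" and ?T = "{u \<in> nbrs_in A X v. light u}"
    note split = deg_split[OF X, of v]
    have light_deg: "deg X u = 3" if "light u" for u using that by (auto simp: light_def light3_def)
    have "?T \<subseteq> heavy_nbrs X v" using light_deg by (auto simp: heavy_nbrs_def)
    then have T_le: "card ?T \<le> card (heavy_nbrs X v)"
      using fin by (intro card_mono) (auto simp: heavy_nbrs_def)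
    have out: "(\<Sum>u \<in> nbrs_in A X v. give v u) = 4 * card ?L + card ?T" if "deg X v \<noteq> 2"
    proof -
      have "give v u = (if deg X u = 2 then 4 else 0) + (if light u then 1 else 0)" for u
        using that light_deg[of u] by (simp add: give_def)
      then show ?thesis using fin by (simp add: sum.distrib sum.If_cases Int_def)
    qed
    have inn: "(\<Sum>u \<in> nbrs_in A X v. give u v) = m * card (heavy_nbrs X v)"
      if m: "\<And>u. deg X u \<noteq> 2 \<Longrightarrow> give u v = m" for m
    proof -
      have "give u v = (if deg X u \<noteq> 2 then m else 0)" for u
        using m[of u] by (simp add: give_def)
      then show ?thesis using fin by (simp add: sum.If_cases Int_def heavy_nbrs_def)
    qed
    consider "deg X v = 2" | "light v" | "deg X v = 3" "\<not> light v" | "deg X v = 4" | "deg X v \<ge> 5"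
      using heavy[OF v] split by linarith
    then show "28 + (\<Sum>u \<in> nbrs_in A X v. give v u) \<le> 10 * deg X v + (\<Sum>u \<in> nbrs_in A X v. give u v)"
    proof cases
      case 1
      have "(\<Sum>u \<in> nbrs_in A X v. give v u) = 0" using 1 by (simp add: give_def)
      moreover have "(\<Sum>u \<in> nbrs_in A X v. give u v) = 4 * card (heavy_nbrs X v)"
        using 1 by (intro inn) (simp add: give_def)
      ultimately show ?thesis using 1 heavy[OF v] by simp
    next
      case 2
      have d: "deg X v = 3" by (rule light_deg[OF 2])
      have "?T = {}" using 2 isolated[OF v] unfolding light_def by blast
      then have T0: "card ?T = 0" by (simp only: card.empty)
      have "(\<Sum>u \<in> nbrs_in A X v. give u v) = 1 * card (heavy_nbrs X v)"
        using 2 d by (intro inn) (simp add: give_def)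
      moreover obtain p where "p \<in> ?L" using 2 by (auto simp: light_def light3_def)
      then have "card ?L \<noteq> 0" using fin by auto
      ultimately show ?thesis using out d heavy[OF v] split T0 by simp
    next
      case 3
      then have "?L = {}" using v by (auto simp: light_def light3_def)
      then have L0: "card ?L = 0" by (simp only: card.empty)
      have "?T \<subset> nbrs_in A X v" using not_all[OF v 3(1)] by (auto simp: light_def)
      then have "card ?T < 3" using psubset_card_mono[OF fin] 3(1) by metis
      then show ?thesis using out 3(1) L0 by simp
    next
      case 4
      then show ?thesis using out heavy[OF v] split T_le by simp
    next
      case 5
      then show ?thesis using out split T_le by simp
    qed
  qed
qed

lemma strong_odd_on_if_reducible:
  assumes "finite V" and red: "\<And>X. X \<subseteq> V \<Longrightarrow> X \<noteq> {} \<Longrightarrow> reducible X k"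
  shows "\<exists>c. strong_odd_on A V k c"
  using assms
proof (induction V rule: finite_psubset_induct)
  case (psubset V)
  show ?case
  proof (cases "V = {}")
    case True
    then show ?thesis by (simp add: strong_odd_on_def)
  next
    case False
    have "\<exists>c. strong_odd_on A Y k c" if "Y \<subset> V" for Y
      using that psubset.prems by (intro psubset.IH) auto
    then show ?thesis using psubset.prems[OF subset_refl False] by (simp add: reducible_def)
  qed
qed

lemma deg_mono: "finite V \<Longrightarrow> X \<subseteq> V \<Longrightarrow> deg X v \<le> deg V v"
  by (rule card_mono) (auto simp: nbrs_in_def)

theorem strong_odd_on_mad_8_3:
  assumes V: "finite V" "\<And>v. v \<in> V \<Longrightarrow> deg V v \<le> D" and k: "D + 3 \<le> k"
    and sparse: "\<And>X. X \<subseteq> V \<Longrightarrow> X \<noteq> {} \<Longrightarrow> 3 * (\<Sum>v \<in> X. deg X v) < 8 * card X"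
  shows "\<exists>c. strong_odd_on A V k c"
proof (rule strong_odd_on_if_reducible[OF V(1)], rule ccontr)
  fix X assume X: "X \<subseteq> V" "X \<noteq> {}" and irr: "\<not> reducible X k"
  have fin: "finite X" using X(1) V(1) by (rule finite_subset)
  have D: "deg X v \<le> D" if "v \<in> X" for v
    using deg_mono[OF V(1) X(1), of v] V(2)[of v] that X(1) by fastforce
  have "2 \<le> card (heavy_nbrs X v)" if "v \<in> X" "deg X v \<le> 3" for v
    using few_heavy_reducible[OF fin that(1) D, of k] irr that(2) k by fastforce
  then have "8 * card X \<le> 3 * (\<Sum>v \<in> X. deg X v)" by (rule dense_if_many_heavy_nbrs_8_3[OF fin])
  then show False using sparse[OF X] by simp
qed

theorem strong_odd_on_mad_14_5:
  assumes V: "finite V" "\<And>v. v \<in> V \<Longrightarrow> deg V v \<le> D" and k: "D + 4 \<le> k"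
    and sparse: "\<And>X. X \<subseteq> V \<Longrightarrow> X \<noteq> {} \<Longrightarrow> 5 * (\<Sum>v \<in> X. deg X v) < 14 * card X"
  shows "\<exists>c. strong_odd_on A V k c"
proof (rule strong_odd_on_if_reducible[OF V(1)], rule ccontr)
  fix X assume X: "X \<subseteq> V" "X \<noteq> {}" and irr: "\<not> reducible X k"
  have fin: "finite X" using X(1) V(1) by (rule finite_subset)
  have D: "deg X v \<le> D" if "v \<in> X" for v
    using deg_mono[OF V(1) X(1), of v] V(2)[of v] that X(1) by fastforce
  have "28 * card X \<le> 10 * (\<Sum>v \<in> X. deg X v)"
  proof (rule dense_if_unavoidable_14_5[OF fin])
    show "2 \<le> card (heavy_nbrs X v)" if "v \<in> X" "deg X v \<le> 4" for v
      using few_heavy_reducible[OF fin that(1) D, of k] irr that(2) k by fastforce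
  next
    fix u v p q assume uv: "u \<in> X" "v \<in> nbrs_in A X u"
    show "\<not> (light3 X u p \<and> light3 X v q)"
    proof
      assume l: "light3 X u p \<and> light3 X v q"
      then have "p \<noteq> v" "q \<noteq> u" by (auto simp: light3_def)
      then show False
        using adjacent_light3_reducible[OF fin D k, of u p v q] l uv irr by (simp add: nbrs_in_def)
    qed
  next
    fix w assume w: "w \<in> X" "deg X w = 3"
    show "\<exists>u \<in> nbrs_in A X w. \<nexists>p. light3 X u p"
    proof (rule ccontr)
      assume "\<not> ?thesis"
      then obtain p where p: "\<And>u. u \<in> nbrs_in A X w \<Longrightarrow> light3 X u (p u)" by metis
      then have "p u \<noteq> w" if "u \<in> nbrs_in A X w" for u using w(2) that p[OF that] by (auto simp: light3_def)
      then show False using light3_star_reducible[OF fin D k w, of p] p irr by blast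
    qed
  qed
  then show False using sparse[OF X] by simp
qed

end

section \<open>Planar graphs of girth seven and eight\<close>

lemma card_induced:
  assumes "finite X"
  shows "card (induced A X) = (\<Sum>v \<in> X. card (nbrs_in A X v))"
proof -
  have "induced A X = Sigma X (nbrs_in A X)" by (auto simp: induced_def nbrs_in_def)
  then show ?thesis using assms by (simp add: nbrs_in_def)
qed

lemma awalk_of_vertex_list:
  "l \<noteq> [] \<Longrightarrow> pcas (hd l) (zip l (tl l)) (last l) \<and> pawalk_verts (hd l) (zip l (tl l)) = l \<and>
     set (zip l (tl l)) \<subseteq> path_arcs l"
  by (induction l rule: path_arcs.induct) auto

lemma pair_graph_parcs:
  assumes "pair_graph G"
  shows "sym (parcs G)" "irrefl (parcs G)" "fst ` parcs G \<subseteq> pverts G"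
proof -
  interpret pair_graph G by fact
  show "sym (parcs G)" using arcs_symmetric by (rule symI)
  show "irrefl (parcs G)" using no_loops' by (auto simp: irrefl_def)
  show "fst ` parcs G \<subseteq> pverts G" using arc_fst_in_verts by (rule image_subsetI)
qed

lemma plane_graph_of_drawing:
  assumes "pair_graph G" "plane_drawing G \<phi> L"
  shows "plane_graph (parcs G) \<phi> L"
proof
  note inV = pair_graph_parcs(3)[OF assms(1)]
  note d = assms(2)[unfolded plane_drawing_def]
  have edge: "\<forall>(u, v) \<in> parcs G. \<exists>g. arc g \<and> pathstart g = \<phi> u \<and> pathfinish g = \<phi> v \<and> path_image g = L {u, v}"
    and vertex: "\<forall>(u, v) \<in> parcs G. \<forall>w \<in> pverts G. \<phi> w \<in> L {u, v} \<longrightarrow> w \<in> {u, v}"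
    and cross: "\<forall>(u, v) \<in> parcs G. \<forall>(x, y) \<in> parcs G. {u, v} \<noteq> {x, y} \<longrightarrow>
        L {u, v} \<inter> L {x, y} \<subseteq> \<phi> ` ({u, v} \<inter> {x, y})"
    by (rule d[THEN conjunct2, THEN conjunct1] d[THEN conjunct2, THEN conjunct2, THEN conjunct1]
          d[THEN conjunct2, THEN conjunct2, THEN conjunct2])+
  show "sym (parcs G)" by (rule pair_graph_parcs(1)[OF assms(1)])
  show "\<exists>g. arc g \<and> pathstart g = \<phi> u \<and> pathfinish g = \<phi> v \<and> path_image g = L {u, v}"
    if "(u, v) \<in> parcs G" for u v
    using bspec[OF edge that] by simp
  show "w \<in> {u, v}" if "(u, v) \<in> parcs G" "w \<in> fst ` parcs G" "\<phi> w \<in> L {u, v}" for u v w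
    using bspec[OF vertex that(1)] inV that(2,3) by blast
  show "L {u, v} \<inter> L {x, y} \<subseteq> \<phi> ` ({u, v} \<inter> {x, y})"
    if "(u, v) \<in> parcs G" "(x, y) \<in> parcs G" "{u, v} \<noteq> {x, y}" for u v x y
    using bspec[OF bspec[OF cross that(1), unfolded prod.case] that(2), unfolded prod.case] that(3) by blast
qed

context
  fixes G :: "'a pair_pre_digraph"
  assumes G: "pair_graph G"
begin

interpretation pair_graph G by (rule G)

lemma girth_le_cycle_length:
  assumes "cycle_in (parcs G) C"
  shows "girth G \<le> enat (length C)"
proof -
  have C: "distinct C" "3 \<le> length C" "path_arcs (C @ [hd C]) \<subseteq> parcs G"
    using assms by (auto simp: cycle_in_def cycle_arcs_def)
  obtain x D where CD: "C = x # D" using C(2) by (cases C) auto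
  let ?l = "C @ [hd C]"
  let ?p = "zip ?l (tl ?l)"
  have len: "length ?p = length C" using CD by simp
  have walk: "pcas x ?p x" "pawalk_verts x ?p = ?l" "set ?p \<subseteq> parcs G"
    using awalk_of_vertex_list[of ?l] C(3) CD by auto
  have "x \<in> fst ` parcs G" using fst_path_arcs[of ?l] C(2,3) CD by force
  then have "x \<in> pverts G" using in_arcsD1 by auto
  moreover have "distinct (tl ?l)" using C(1) CD by simp
  moreover have "?p \<noteq> []" using C(2) CD by (cases D) auto
  ultimately have "pre_digraph.cycle (with_proj G) ?p"
    unfolding pre_digraph.cycle_def pre_digraph.awalk_def cas_with_proj_eq awalk_verts_with_proj_eq
    using walk by (intro exI[of _ x]) simp
  then obtain p where p: "pre_digraph.cycle (with_proj G) p" "length p = length C" using len by blast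
  then have "enat (length C) \<in> {enat (length p) | p. pre_digraph.cycle (with_proj G) p \<and> 3 \<le> length p}"
    using C(2) by (intro CollectI exI[of _ p]) simp
  then show ?thesis unfolding girth_def by (rule Inf_lower)
qed

lemma nbrs_eq_nbrs_in: "nbrs G v = nbrs_in (parcs G) (pverts G) v"
  using in_arcsD2 by (auto simp: nbrs_def nbrs_in_def)

lemma degree_le_max_degree:
  assumes "v \<in> pverts G"
  shows "card (nbrs_in (parcs G) (pverts G) v) \<le> max_degree G"
proof -
  have "out_arcs (with_proj G) v = Pair v ` nbrs G v" by (auto simp: out_arcs_def nbrs_def)
  then have "out_degree (with_proj G) v = card (nbrs_in (parcs G) (pverts G) v)"
    by (simp add: out_degree_def card_image inj_on_def nbrs_eq_nbrs_in)
  then show ?thesis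
    unfolding max_degree_def using assms pair_finite_verts by (metis Max_ge finite_imageI finite_insert imageI insertCI)
qed

lemma chromatic_number_le:
  assumes "strong_odd_on (parcs G) (pverts G) k c" "0 < k"
  shows "strong_odd_chromatic_number G \<le> k"
proof -
  have "strong_odd_coloring G k c"
    unfolding strong_odd_coloring_def nbrs_eq_nbrs_in
  proof (intro conjI ballI impI, goal_cases)
    case (1 v)
    then show ?case using assms(1) by (auto simp: strong_odd_on_def)
  next
    case (2 e)
    obtain u v where e: "e = (u, v)" by (cases e)
    then have "u \<in> pverts G" "v \<in> nbrs_in (parcs G) (pverts G) u" using 2 in_arcsD1 in_arcsD2 by (auto simp: nbrs_in_def)
    then show ?case using assms(1) e by (auto simp: strong_odd_on_def)
  next
    case (3 v i)
    then show ?case using assms(1) by (auto simp: strong_odd_on_def odd_classes_def)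
  qed
  then show ?thesis
    unfolding strong_odd_chromatic_number_def using assms(2) by (intro Least_le) auto
qed

lemma planar_sparse:
  assumes "planar G" and g: "enat g \<le> girth G" "2 \<le> g" and X: "X \<subseteq> pverts G" "X \<noteq> {}"
  shows "g * (\<Sum>v \<in> X. card (nbrs_in (parcs G) X v)) + 2 * g
    \<le> 2 * (\<Sum>v \<in> X. card (nbrs_in (parcs G) X v)) + 2 * g * card X"
proof -
  have fin: "finite X" using X(1) pair_finite_verts by (rule finite_subset)
  obtain \<phi> L where "plane_drawing G \<phi> L" using assms(1) by (auto simp: planar_def)
  then interpret plane: plane_graph "parcs G" \<phi> L by (rule plane_graph_of_drawing[OF G])
  have "g \<le> length C" if "cycle_in (parcs G) C" for C
    using order_trans[OF g(1) girth_le_cycle_length[OF that]] by simp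
  from plane.plane_graph_sparse[OF fin X(2) pair_graph_parcs(2)[OF G] this g(2)]
  show ?thesis by (simp only: card_induced[OF fin])
qed

lemma girth7_parcs:
  assumes "enat 7 \<le> girth G"
  shows "girth7 (parcs G)"
proof
  fix C assume "cycle_in (parcs G) C"
  then show "7 \<le> length C" using order_trans[OF assms girth_le_cycle_length] by simp
qed (rule pair_graph_parcs[OF G])+

end

theorem corollary1p4:
  fixes G :: "'a pair_pre_digraph"
  assumes "pair_graph G" and "planar G"
  shows "(girth G \<ge> 7 \<longrightarrow> strong_odd_chromatic_number G \<le> max_degree G + 4) \<and>
         (girth G \<ge> 8 \<longrightarrow> strong_odd_chromatic_number G \<le> max_degree G + 3)"
proof -
  interpret pair_graph G by fact
  have seven: "(7::enat) = enat 7" and eight: "(8::enat) = enat 8" by (simp_all add: numeral_eq_enat)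
  show ?thesis
  proof (intro conjI impI)
    assume "7 \<le> girth G"
    then have g: "enat 7 \<le> girth G" by (simp only: seven)
    interpret girth7 "parcs G" by (rule girth7_parcs[OF assms(1) g])
    have "5 * (\<Sum>v \<in> X. deg X v) < 14 * card X" if "X \<subseteq> pverts G" "X \<noteq> {}" for X
      using planar_sparse[OF assms g _ that] by simp
    from strong_odd_on_mad_14_5[OF pair_finite_verts degree_le_max_degree[OF assms(1)] order_refl this]
    obtain c where "strong_odd_on (parcs G) (pverts G) (max_degree G + 4) c" by blast
    then show "strong_odd_chromatic_number G \<le> max_degree G + 4"
      by (rule chromatic_number_le[OF assms(1)]) simp
  next
    assume "8 \<le> girth G"
    then have g: "enat 8 \<le> girth G" by (simp only: eight)
    then have "enat 7 \<le> girth G" by (rule order_trans[rotated]) simp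
    then interpret girth7 "parcs G" by (rule girth7_parcs[OF assms(1)])
    have "3 * (\<Sum>v \<in> X. deg X v) < 8 * card X" if "X \<subseteq> pverts G" "X \<noteq> {}" for X
      using planar_sparse[OF assms g _ that] by simp
    from strong_odd_on_mad_8_3[OF pair_finite_verts degree_le_max_degree[OF assms(1)] order_refl this]
    obtain c where "strong_odd_on (parcs G) (pverts G) (max_degree G + 3) c" by blast
    then show "strong_odd_chromatic_number G \<le> max_degree G + 3"
      by (rule chromatic_number_le[OF assms(1)]) simp
  qed
qed

end
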